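(* Let $n\geq 2$ and let $\gamma:\mathbb C^n\to\mathbb C^n$ be a biholomorphic contraction at $0$. Let $G^1_\alpha\subset GL(n,\mathbb C)$ be the linear group determined by the eigenvalues $\alpha$ of $d_0\gamma$ (defined in the context). Then there exists a holomorphic $G^1_\alpha$-structure of order $1$ on $\mathbb C^n$ which is invariant under the action of the group $\langle\gamma\rangle$ generated by $\gamma$.
   Context: A biholomorphic contraction at $0$ is a biholomorphism $\gamma:\mathbb C^n\to\mathbb C^n$ such that for every compact $K\subset\mathbb C^n$ and every neighborhood $U$ of $0$, $\gamma^N(K)\subset U$ for all sufficiently large $N$; then $\gamma(0)=0$ and all eigenvalues of $d_0\gamma$ have modulus in $(0,1)$. Let $\alpha_1,\dots,\alpha_m$ be the distinct eigenvalues of $d_0\gamma$, with algebraic multiplicities $n_1,\dots,n_m$, numbered so that $1>|\alpha_1|\geq\dots\geq|\alpha_m|>0$. For $i\in\{1,\dots,n\}$ let $k_i\in\{1,\dots,m\}$ be the index with $n_1+\dots+n_{k_i-1}<i\leq n_1+\dots+n_{k_i}$. One says that $\alpha_j$ is dependent on $\alpha_k$ if there is $p\in\mathbb N^m$ (possibly $p=0$) with $\alpha_j=\alpha_k\prod_{l=1}^m\alpha_l^{p_l}$, and independent on $\alpha_k$ otherwise. $G^1_\alpha$ is the complex Lie group of invertible lower triangular $n\times n$ matrices $A=(a_{i,j})$ such that, for $i>j$, $a_{i,j}=0$ whenever $\alpha_{k_i}$ is independent on $\alpha_{k_j}$. For a complex Lie subgroup $G\subset GL(n,\mathbb C)$,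 a holomorphic $G$-structure of order $1$ on a complex manifold $X$ of dimension $n$ is a holomorphic principal $G$-sub-bundle of the bundle $\mathcal R^1(X)$ of linear frames of the holomorphic tangent bundle $TX$. It is invariant under a biholomorphism $\gamma$ of $X$ if it is preserved by the map of $\mathcal R^1(X)$ induced by $d\gamma$. *)

theory Defs
  imports "HOL-Analysis.Analysis" "HOL-Computational_Algebra.Polynomial"
begin

text \<open>
  The space \<open>\<complex>\<^sup>n\<close> is \<^typ>\<open>complex ^ 'n\<close>. The index type is a finite linear order, standing for
  \<open>{1, \<dots>, n}\<close>; the order is used for lower triangularity and for the numbering \<open>k\<^sub>i\<close>.
\<close>

definition holomorphic_fun_on :: "(complex ^ 'n \<Rightarrow> complex) \<Rightarrow> (complex ^ 'n) set \<Rightarrow> bool" where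
  "holomorphic_fun_on f S \<longleftrightarrow>
     (\<forall>x\<in>S. \<exists>D. (f has_derivative D) (at x) \<and> (\<forall>c v. D (c *s v) = c * D v))"

definition holomorphic_map :: "(complex ^ 'n \<Rightarrow> complex ^ 'm) \<Rightarrow> bool" where
  "holomorphic_map f \<longleftrightarrow> (\<forall>i. holomorphic_fun_on (\<lambda>x. f x $ i) UNIV)"

definition biholomorphism :: "(complex ^ 'n \<Rightarrow> complex ^ 'n) \<Rightarrow> bool" where
  "biholomorphism f \<longleftrightarrow> bij f \<and> holomorphic_map f \<and> holomorphic_map (inv f)"

definition contraction_at_0 :: "(complex ^ 'n \<Rightarrow> complex ^ 'n) \<Rightarrow> bool" where
  "contraction_at_0 f \<longleftrightarrow> biholomorphism f \<and>
     (\<forall>K U. compact K \<and> open U \<and> 0 \<in> U \<longrightarrow> (\<forall>\<^sub>F N in sequentially. (f ^^ N) ` K \<subseteq> U))"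


definition eigenvalues :: "complex ^ 'n ^ 'n \<Rightarrow> complex set" where
  "eigenvalues A = {c. \<exists>v. v \<noteq> 0 \<and> A *v v = c *s v}"

definition charpoly :: "complex ^ 'n ^ 'n \<Rightarrow> complex poly" where
  "charpoly A = det (mat [:0, 1:] - map_matrix (\<lambda>a. [:a:]) A)"

definition alg_multiplicity :: "complex ^ 'n ^ 'n \<Rightarrow> complex \<Rightarrow> nat" where
  "alg_multiplicity A c = order c (charpoly A)"

text \<open>
  \<open>\<alpha> 1, \<dots>, \<alpha> m\<close> are the distinct eigenvalues of \<open>A\<close>, in order of decreasing modulus (the
  choice among eigenvalues of equal modulus is free). Values of \<open>\<alpha>\<close> outside \<open>{1..m}\<close> are never used.
\<close>
definition eigenvalue_numbering :: "complex ^ 'n ^ 'n \<Rightarrow> nat \<Rightarrow> (nat \<Rightarrow> complex) \<Rightarrow> bool" where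
  "eigenvalue_numbering A m \<alpha> \<longleftrightarrow> bij_betw \<alpha> {1..m} (eigenvalues A) \<and>
     (\<forall>j\<in>{1..m}. \<forall>k\<in>{1..m}. j \<le> k \<longrightarrow> cmod (\<alpha> k) \<le> cmod (\<alpha> j))"

definition dependent_on :: "nat \<Rightarrow> (nat \<Rightarrow> complex) \<Rightarrow> nat \<Rightarrow> nat \<Rightarrow> bool" where
  "dependent_on m \<alpha> j k \<longleftrightarrow> (\<exists>p :: nat \<Rightarrow> nat. \<alpha> j = \<alpha> k * (\<Prod>l=1..m. \<alpha> l ^ p l))"

definition position :: "'n::{finite,linorder} \<Rightarrow> nat" where
  "position i = card {j. j \<le> i}"

text \<open>
  The index \<open>k\<^sub>i\<close> for multiplicities \<open>\<mu> 1, \<dots>, \<mu> m\<close>. It is uniquely determined when these are positive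
  with sum \<open>n\<close>, as for the algebraic multiplicities of all eigenvalues of a matrix.
\<close>
definition eig_index :: "nat \<Rightarrow> (nat \<Rightarrow> nat) \<Rightarrow> 'n::{finite,linorder} \<Rightarrow> nat" where
  "eig_index m \<mu> i =
     (THE k. k \<in> {1..m} \<and> (\<Sum>l\<in>{1..<k}. \<mu> l) < position i \<and> position i \<le> (\<Sum>l\<in>{1..k}. \<mu> l))"

definition G1_alpha ::
  "nat \<Rightarrow> (nat \<Rightarrow> complex) \<Rightarrow> (nat \<Rightarrow> nat) \<Rightarrow> (complex ^ 'n::{finite,linorder} ^ 'n::{finite,linorder}) set" where
  "G1_alpha m \<alpha> \<mu> = {A. invertible A \<and> (\<forall>i j. i < j \<longrightarrow> A $ i $ j = 0) \<and>
     (\<forall>i j. j < i \<and> \<not> dependent_on m \<alpha> (eig_index m \<mu> i) (eig_index m \<mu> j) \<longrightarrow> A $ i $ j = 0)}"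


text \<open>
  In the global coordinates of \<open>\<complex>\<^sup>n\<close>, the frame bundle is \<open>\<complex>\<^sup>n \<times> GL(n, \<complex>)\<close>: the pair \<open>(x, F)\<close> is the
  frame of the tangent space at \<open>x\<close> whose vectors are the columns of \<open>F\<close>. The structure group acts on
  the right by \<open>(x, F) \<cdot> g = (x, F ** g)\<close>.
\<close>
definition frame_bundle :: "((complex ^ 'n) \<times> (complex ^ 'n ^ 'n)) set" where
  "frame_bundle = {(x, F). invertible F}"

text \<open>
  \<open>P\<close> is a holomorphic principal \<open>G\<close>-sub-bundle: it is stable under \<open>G\<close>, and near every point a
  holomorphic frame field \<open>s\<close> on an open set \<open>U\<close> gives a \<open>G\<close>-equivariant trivialization
  \<open>U \<times> G \<rightarrow> P|U\<close>, \<open>(y, g) \<mapsto> (y, s y ** g)\<close>. This is the restriction of the biholomorphism of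
  \<open>U \<times> GL(n, \<complex>)\<close> given by the same formula. The group \<open>G\<close> is meant to be a complex Lie
  subgroup of \<open>GL(n, \<complex>)\<close>.
\<close>
definition holomorphic_G_structure ::
  "(complex ^ 'n ^ 'n) set \<Rightarrow> ((complex ^ 'n) \<times> (complex ^ 'n ^ 'n)) set \<Rightarrow> bool" where
  "holomorphic_G_structure G P \<longleftrightarrow>
     P \<subseteq> frame_bundle \<and>
     (\<forall>x F g. (x, F) \<in> P \<and> g \<in> G \<longrightarrow> (x, F ** g) \<in> P) \<and>
     (\<forall>x. \<exists>U s. open U \<and> x \<in> U \<and>
        (\<forall>i j. holomorphic_fun_on (\<lambda>y. s y $ i $ j) U) \<and>
        (\<forall>y\<in>U. invertible (s y) \<and> {F. (y, F) \<in> P} = (\<lambda>g. s y ** g) ` G))"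

definition frame_map ::
  "(complex ^ 'n \<Rightarrow> complex ^ 'n) \<Rightarrow> (complex ^ 'n) \<times> (complex ^ 'n ^ 'n) \<Rightarrow> (complex ^ 'n) \<times> (complex ^ 'n ^ 'n)" where
  "frame_map f = (\<lambda>(x, F). (f x, jacobian f (at x) ** F))"

definition invariant_under ::
  "(complex ^ 'n \<Rightarrow> complex ^ 'n) \<Rightarrow> ((complex ^ 'n) \<times> (complex ^ 'n ^ 'n)) set \<Rightarrow> bool" where
  "invariant_under f P \<longleftrightarrow> frame_map f ` P = P"

definition generated_group :: "('a \<Rightarrow> 'a) \<Rightarrow> ('a \<Rightarrow> 'a) set" where
  "generated_group f = range (\<lambda>N. f ^^ N) \<union> range (\<lambda>N. inv f ^^ N)"

end

theory Submission
  imports Defs "HOL-Complex_Analysis.Cauchy_Integral_Formula"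
    "HOL-Computational_Algebra.Fundamental_Theorem_Algebra" "HOL-Library.Function_Algebras"
begin

text \<open>
  The structure is spanned by a global holomorphic frame \<open>X\<^sub>1, \<dots>, X\<^sub>n\<close> of \<open>\<complex>\<^sup>n\<close> made of generalised eigenfields of the
  contraction \<open>\<gamma>\<close>. Write \<open>L\<close> for its linear part at \<open>0\<close> and \<open>\<beta>\<^sub>1, \<dots>, \<beta>\<^sub>n\<close> for the eigenvalues of \<open>L\<close> repeated with
  multiplicity, sorted by class.

  Eigenfields exist for the following reason (lemma \<open>generalised_eigenfield\<close>). Pull-back by \<open>\<gamma>\<close> acts on entire vector fields
  and on entire \<open>1\<close>-forms. On the fields that vanish to high order at \<open>0\<close> it is as contracting as desired, since the
  contraction of \<open>\<gamma>\<close> beats the growth of the derivative cocycle; there, pull-back minus a nonzero scalar is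
  onto by a Neumann series. These fields have finite codimension, so a Fitting argument lifts every generalised eigenvector
  of \<open>L\<close> at the fixed point to an entire generalised eigenfield or eigenform. A basis of \<open>\<complex>\<^sup>n\<close>
  in which \<open>L\<close> is lower triangular and block diagonal thus extends to fields \<open>X\<^sub>i\<close>, with eigenvalue \<open>1 / \<beta>\<^sub>i\<close>, and its dual
  basis extends to forms \<open>\<theta>\<^sub>l\<close>, with eigenvalue \<open>\<beta>\<^sub>l\<close>.

  The pairing \<open>\<theta>\<^sub>l(X\<^sub>i)\<close> is a generalised eigenfunction of composition with \<open>\<gamma>\<close>, with eigenvalue \<open>\<beta>\<^sub>l / \<beta>\<^sub>i\<close>. All eigenvalues
  of composition with \<open>\<gamma>\<close> are monomials in the \<open>\<beta>\<^sub>j\<close> (lemma \<open>eigenvalue_is_monomial\<close>): the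
  derivative of an eigenfunction along \<open>X\<^sub>j\<close> is an eigenfunction whose eigenvalue is divided by \<open>\<beta>\<^sub>j\<close>, and this cannot go on
  since eigenvalues have modulus at most one. Hence the matrix \<open>\<theta>\<^sub>l(X\<^sub>i)\<close> can have a nonzero entry only where
  \<open>\<beta>\<^sub>l\<close> is dependent on \<open>\<beta>\<^sub>i\<close>. Comparing moduli, and using that eigenfunctions for the eigenvalue one are
  constant, it is lower triangular with ones on the diagonal. So it lies in \<open>G\<^sup>1\<^sub>\<alpha>\<close>; in particular
  the \<open>X\<^sub>i\<close> form a frame everywhere. The same holds, up to the constant diagonal, for the pairings of the \<open>\<theta>\<^sub>l\<close> with
  the pulled back fields. As \<open>G\<^sup>1\<^sub>\<alpha>\<close> is the unit group of an incidence algebra, pull-back changes the frame by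
  matrices in \<open>G\<^sup>1\<^sub>\<alpha>\<close>, which is the invariance of the structure spanned by it.
\<close>

section \<open>Entire functions of several complex variables\<close>

abbreviation entire :: "(complex ^ 'n \<Rightarrow> complex) \<Rightarrow> bool" where
  "entire f \<equiv> holomorphic_fun_on f UNIV"

abbreviation dir_deriv :: "(complex ^ 'n \<Rightarrow> complex) \<Rightarrow> complex ^ 'n \<Rightarrow> complex ^ 'n \<Rightarrow> complex" where
  "dir_deriv f v x \<equiv> frechet_derivative f (at x) v"

lemma entire_has_derivative:
  assumes "entire f"
  shows "(f has_derivative frechet_derivative f (at x)) (at x)"
  using assms unfolding holomorphic_fun_on_def
  by (metis UNIV_I differentiableI frechet_derivative_works)

lemma dir_deriv_scale:
  assumes "entire f"
  shows "dir_deriv f (c *s v) x = c * dir_deriv f v x"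
  using assms unfolding holomorphic_fun_on_def
  by (metis UNIV_I frechet_derivative_at)

lemma dir_deriv_eq:
  assumes "(f has_derivative D) (at x)"
  shows "dir_deriv f v x = D v"
  using frechet_derivative_at[OF assms] by simp

lemma dir_deriv_linear:
  assumes "entire f"
  shows "linear (\<lambda>v. dir_deriv f v x)"
  using entire_has_derivative[OF assms] has_derivative_linear by blast

lemma entireI:
  assumes "\<And>x. (f has_derivative D x) (at x)" "\<And>x c v. D x (c *s v) = c * D x v"
  shows "entire f"
  using assms unfolding holomorphic_fun_on_def by blast

lemma entire_continuous: "entire f \<Longrightarrow> continuous_on S f"
  by (meson UNIV_I continuous_at_imp_continuous_on entire_has_derivative has_derivative_continuous)

lemma entire_const [simp]: "entire (\<lambda>x. c)"
  by (rule entireI[of _ "\<lambda>x v. 0"]) auto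

lemma entire_nth [simp]: "entire (\<lambda>x. x $ i)"
  by (rule entireI[of _ "\<lambda>x v. v $ i"])
    (auto intro: bounded_linear_imp_has_derivative bounded_linear_vec_nth)

lemma entire_add:
  assumes "entire f" "entire g" shows "entire (\<lambda>x. f x + g x)"
  using has_derivative_add[OF assms[THEN entire_has_derivative]]
  by (rule entireI) (simp add: dir_deriv_scale assms algebra_simps)

lemma entire_mult:
  assumes "entire f" "entire g" shows "entire (\<lambda>x. f x * g x)"
  using has_derivative_mult[OF assms[THEN entire_has_derivative]]
  by (rule entireI) (simp add: dir_deriv_scale assms algebra_simps)

lemma entire_diff:
  assumes "entire f" "entire g" shows "entire (\<lambda>x. f x - g x)"
  using has_derivative_diff[OF assms[THEN entire_has_derivative]]
  by (rule entireI) (simp add: dir_deriv_scale assms algebra_simps)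

lemma entire_cmult: "entire f \<Longrightarrow> entire (\<lambda>x. c * f x)"
  by (intro entire_mult entire_const)

lemma entire_divide: "entire f \<Longrightarrow> entire (\<lambda>x. f x / c)"
  using entire_cmult[of f "1 / c"] by simp

lemma entire_sum: "(\<And>i. i \<in> I \<Longrightarrow> entire (f i)) \<Longrightarrow> entire (\<lambda>x. \<Sum>i\<in>I. f i x)"
  by (induction I rule: infinite_finite_induct) (auto intro: entire_add)

lemma has_derivative_vec:
  fixes f :: "'a::real_normed_vector \<Rightarrow> complex ^ 'n"
  assumes "\<And>i. ((\<lambda>x. f x $ i) has_derivative D i) (at x)"
  shows "(f has_derivative (\<lambda>v. \<chi> i. D i v)) (at x)"
proof -
  have "((\<lambda>x. f x \<bullet> b) has_derivative (\<lambda>v. (\<chi> i. D i v) \<bullet> b)) (at x)" if "b \<in> Basis" for b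
  proof -
    from that obtain i u where b: "b = axis i u" by (auto simp: Basis_vec_def)
    show ?thesis unfolding b inner_axis
      using has_derivative_inner_left[OF assms[of i], of u] by simp
  qed
  then show ?thesis using has_derivative_componentwise_within[of f] by blast
qed

lemma holomorphic_map_has_derivative:
  assumes "holomorphic_map g"
  shows "(g has_derivative (\<lambda>v. \<chi> i. dir_deriv (\<lambda>y. g y $ i) v x)) (at x)"
  using assms unfolding holomorphic_map_def
  by (intro has_derivative_vec entire_has_derivative) auto

lemma holomorphic_map_continuous: "holomorphic_map g \<Longrightarrow> continuous_on S g"
  by (meson continuous_at_imp_continuous_on holomorphic_map_has_derivative has_derivative_continuous)

lemma entire_compose:
  assumes "entire f" "holomorphic_map g" shows "entire (\<lambda>x. f (g x))"
proof (rule entireI)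
  show "((\<lambda>x. f (g x)) has_derivative
      (\<lambda>v. dir_deriv f (\<chi> i. dir_deriv (\<lambda>y. g y $ i) v x) (g x))) (at x)" for x
    using has_derivative_compose[OF holomorphic_map_has_derivative[OF assms(2)]
        entire_has_derivative[OF assms(1)]] .
  have g: "entire (\<lambda>y. g y $ i)" for i using assms(2) holomorphic_map_def by blast
  show "dir_deriv f (\<chi> i. dir_deriv (\<lambda>y. g y $ i) (c *s v) x) (g x)
      = c * dir_deriv f (\<chi> i. dir_deriv (\<lambda>y. g y $ i) v x) (g x)" for c v x
    using dir_deriv_scale[OF assms(1), of _ c "\<chi> i. dir_deriv (\<lambda>y. g y $ i) v x"]
    by (simp add: dir_deriv_scale[OF g]) (simp add: vector_scalar_mult_def)
qed

lemma holomorphic_map_compose: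
  assumes "holomorphic_map f" "holomorphic_map g" shows "holomorphic_map (\<lambda>x. f (g x))"
  using assms entire_compose unfolding holomorphic_map_def by blast

lemma holomorphic_map_funpow:
  fixes f :: "complex ^ 'n \<Rightarrow> complex ^ 'n"
  shows "holomorphic_map f \<Longrightarrow> holomorphic_map (f ^^ N)"
proof (induction N)
  case 0 show ?case by (simp add: holomorphic_map_def)
next
  case (Suc N) then show ?case
    using holomorphic_map_compose[of f "f ^^ N"] by (simp add: comp_def)
qed

lemma jacobian_nth:
  fixes g :: "complex ^ 'n \<Rightarrow> complex ^ 'm"
  assumes "holomorphic_map g"
  shows "jacobian g (at x) $ i $ j = dir_deriv (\<lambda>y. g y $ i) (axis j 1) x"
  unfolding jacobian_def matrix_def
  using frechet_derivative_at[OF holomorphic_map_has_derivative[OF assms, of x]] 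
  by (metis (no_types, lifting) vec_lambda_beta)

lemma dir_deriv_expand:
  fixes f :: "complex ^ 'n \<Rightarrow> complex"
  assumes "entire f"
  shows "dir_deriv f v x = (\<Sum>j\<in>UNIV. v $ j * dir_deriv f (axis j 1) x)"
proof -
  have "dir_deriv f v x = dir_deriv f (\<Sum>j\<in>UNIV. v $ j *s axis j 1) x"
    by (simp add: basis_expansion)
  also have "\<dots> = (\<Sum>j\<in>UNIV. dir_deriv f (v $ j *s axis j 1) x)"
    using linear_sum[OF dir_deriv_linear[OF assms]] .
  finally show ?thesis by (simp add: dir_deriv_scale[OF assms])
qed

lemma holomorphic_map_has_jacobian:
  assumes "holomorphic_map g"
  shows "(g has_derivative (\<lambda>v. jacobian g (at x) *v v)) (at x)"
proof -
  have "entire (\<lambda>y. g y $ i)" for i using assms holomorphic_map_def by blast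
  then have "(\<lambda>v. \<chi> i. dir_deriv (\<lambda>y. g y $ i) v x) = (\<lambda>v. jacobian g (at x) *v v)"
    by (simp add: fun_eq_iff vec_eq_iff matrix_vector_mult_def jacobian_nth[OF assms] 
       dir_deriv_expand[of "\<lambda>y. g y $ _"] mult.commute)
  then show ?thesis using holomorphic_map_has_derivative[OF assms, of x] by simp
qed

lemma jacobian_compose:
  fixes f :: "complex ^ 'n \<Rightarrow> complex ^ 'm" and g :: "complex ^ 'l \<Rightarrow> complex ^ 'n"
  assumes "holomorphic_map f" "holomorphic_map g"
  shows "jacobian (\<lambda>x. f (g x)) (at x) = jacobian f (at (g x)) ** jacobian g (at x)"
proof -
  have "((\<lambda>x. f (g x)) has_derivative (\<lambda>v. (jacobian f (at (g x)) ** jacobian g (at x)) *v v)) (at x)"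
    using has_derivative_compose[OF holomorphic_map_has_jacobian[OF assms(2)]
        holomorphic_map_has_jacobian[OF assms(1)]] by (simp add: matrix_vector_mul_assoc)
  from frechet_derivative_at[OF this, symmetric] show ?thesis
    by (simp add: jacobian_def)
qed

lemma dir_deriv_compose:
  assumes "entire f" "holomorphic_map g"
  shows "dir_deriv (\<lambda>x. f (g x)) v x = dir_deriv f (jacobian g (at x) *v v) (g x)"
  by (rule dir_deriv_eq) (rule has_derivative_compose[OF holomorphic_map_has_jacobian[OF assms(2)]
        entire_has_derivative[OF assms(1)]])

text \<open>
  The several-variable theory is reduced to one variable by restricting to the complex lines \<open>z \<mapsto> x + z v\<close>.
\<close>
lemma entire_on_line:
  assumes "entire f"
  shows "((\<lambda>z. f (x + z *s v)) has_field_derivative dir_deriv f v (x + z *s v)) (at z)"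
proof -
  have "((\<lambda>z. x + z *s v) has_derivative (\<lambda>h. h *s v)) (at z)"
    unfolding vector_scalar_mult_def
    by (rule has_derivative_eq_rhs, rule has_derivative_vec)
      (auto intro!: derivative_eq_intros simp: mult.commute)
  from has_derivative_compose[OF this entire_has_derivative[OF assms]]
  show ?thesis unfolding has_field_derivative_def
    by (simp add: dir_deriv_scale[OF assms] mult.commute[of _ "dir_deriv f v (x + z *s v)"])
qed

lemma line_holomorphic: "entire f \<Longrightarrow> (\<lambda>z. f (x + z *s v)) holomorphic_on S"
  unfolding holomorphic_on_def field_differentiable_def
  by (blast intro: entire_on_line has_field_derivative_at_within)

lemma norm_scale_complex [simp]: "norm (c *s (v :: complex ^ 'n)) = cmod c * norm v"
  by (simp add: norm_vec_def vector_scalar_mult_def norm_mult L2_set_right_distrib)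

text \<open>
  A bound on the values alone controls the derivative, so uniform convergence of functions passes to their
  derivatives on smaller balls.
\<close>
lemma Cauchy_estimate_dir_deriv:
  fixes f :: "complex ^ 'n \<Rightarrow> complex"
  assumes f: "entire f" and r: "r > 0" and M: "\<And>y. y \<in> cball x r \<Longrightarrow> cmod (f y) \<le> M"
  shows "cmod (dir_deriv f v x) \<le> M * norm v / r"
proof (cases "v = 0")
  case True
  then show ?thesis using linear_0[OF dir_deriv_linear[OF f]] by simp
next
  case False
  let ?g = "\<lambda>z. f (x + z *s v)"
  have hol: "?g holomorphic_on S" for S by (rule line_holomorphic[OF f])
  have "norm ((deriv ^^ 1) ?g 0) \<le> fact 1 * M / (r / norm v) ^ 1"
  proof (rule Cauchy_inequality)
    show "?g holomorphic_on ball 0 (r / norm v)" "continuous_on (cball 0 (r / norm v)) ?g"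
      using hol holomorphic_on_imp_continuous_on by blast+
    show "0 < r / norm v" using r False by simp
    show "cmod (f (x + y *s v)) \<le> M" if "cmod (0 - y) = r / norm v" for y
      using that False r by (intro M) (simp add: dist_norm)
  qed
  then show ?thesis using DERIV_imp_deriv[OF entire_on_line[OF f, of x v 0]] by simp
qed

text \<open>
  By the Cauchy estimate the derivatives converge locally uniformly as well.
\<close>
lemma entire_uniform_limit:
  fixes f :: "nat \<Rightarrow> complex ^ 'n \<Rightarrow> complex"
  assumes f: "\<And>k. entire (f k)" and lim: "\<And>R. uniform_limit (cball 0 R) f g sequentially"
  shows "entire g"
proof (rule entireI)
  define D where "D x v = lim (\<lambda>k. dir_deriv (f k) v x)" for x v
  have cauchy: "\<exists>N. \<forall>k\<ge>N. \<forall>l\<ge>N. \<forall>x\<in>ball 0 R. \<forall>v. 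
      cmod (dir_deriv (f k) v x - dir_deriv (f l) v x) \<le> e * norm v" if "e > 0" for e R
  proof -
    obtain N where N: "\<And>k x. k \<ge> N \<Longrightarrow> x \<in> cball 0 (R + 1) \<Longrightarrow> dist (f k x) (g x) < e / 2"
      using uniform_limitD[OF lim[of "R + 1"], of "e / 2"] \<open>e > 0\<close>
      unfolding eventually_sequentially by (meson half_gt_zero)
    have "cmod (dir_deriv (f k) v x - dir_deriv (f l) v x) \<le> e * norm v"
      if kl: "k \<ge> N" "l \<ge> N" and x: "x \<in> ball 0 R" for k l x v
    proof -
      have "cmod (dir_deriv (\<lambda>y. f k y - f l y) v x) \<le> e * norm v / 1"
      proof (rule Cauchy_estimate_dir_deriv)
        fix y assume "y \<in> cball x 1"
        then have "norm y \<le> R + 1"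
          using x norm_triangle_sub[of y x] by (simp add: dist_norm norm_minus_commute)
        then show "cmod (f k y - f l y) \<le> e"
          using dist_triangle_half_l[OF N[OF kl(1), of y] N[OF kl(2), of y]] by (simp add: dist_norm)
      qed (auto intro: entire_diff f)
      moreover have "dir_deriv (\<lambda>y. f k y - f l y) v x = dir_deriv (f k) v x - dir_deriv (f l) v x"
        by (intro dir_deriv_eq has_derivative_diff entire_has_derivative f)
      ultimately show ?thesis by simp
    qed
    then show ?thesis by blast
  qed
  have conv: "(\<lambda>k. dir_deriv (f k) v x) \<longlonglongrightarrow> D x v" for x v
  proof -
    have "Cauchy (\<lambda>k. dir_deriv (f k) v x)"
    proof (rule metric_CauchyI)
      fix e :: real assume "e > 0"
      then have "e / (norm v + 1) > 0"
        by (smt (verit) divide_pos_pos norm_ge_zero)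
      have x_in: "x \<in> ball 0 (norm x + 1)" by simp
      from cauchy[OF \<open>e / (norm v + 1) > 0\<close>, of "norm x + 1"] obtain N where N: 
        "\<And>k l. k \<ge> N \<Longrightarrow> l \<ge> N \<Longrightarrow> cmod (dir_deriv (f k) v x - dir_deriv (f l) v x) \<le> e / (norm v + 1) * norm v"
        using x_in by meson
      have "e / (norm v + 1) * norm v < e"
        using \<open>e > 0\<close> by (simp add: field_simps add_pos_nonneg)
      with N show "\<exists>M. \<forall>m\<ge>M. \<forall>n\<ge>M. dist (dir_deriv (f m) v x) (dir_deriv (f n) v x) < e"
        unfolding dist_norm by (meson le_less_trans)
    qed
    then show ?thesis unfolding D_def by (simp add: Cauchy_convergent_iff convergent_LIMSEQ_iff)
  qed
  have glim: "(\<lambda>k. f k x) \<longlonglongrightarrow> g x" for x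
    using tendsto_uniform_limitI[OF lim[of "norm x"], of x] by simp
  show "(g has_derivative D x) (at x)" for x
  proof -
    let ?S = "ball (0 :: complex ^ 'n) (norm x + 1)"
    have "\<exists>h. \<forall>y\<in>?S. (\<lambda>k. f k y) \<longlonglongrightarrow> h y \<and> (h has_derivative D y) (at y within ?S)"
    proof (rule has_derivative_sequence)
      show "(f k has_derivative frechet_derivative (f k) (at y)) (at y within ?S)" for k y
        by (rule has_derivative_at_withinI) (rule entire_has_derivative[OF f])
      show "\<forall>\<^sub>F k in sequentially. \<forall>y\<in>?S. \<forall>h. cmod (dir_deriv (f k) h y - D y h) \<le> e * norm h"
        if "e > 0" for e
      proof -
        from cauchy[OF that, of "norm x + 1"] obtain N where N:
          "\<And>k l y v. k \<ge> N \<Longrightarrow> l \<ge> N \<Longrightarrow> y \<in> ?S \<Longrightarrow>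
            cmod (dir_deriv (f k) v y - dir_deriv (f l) v y) \<le> e * norm v"
          by meson
        have "cmod (dir_deriv (f k) h y - D y h) \<le> e * norm h" if "k \<ge> N" "y \<in> ?S" for k y h
        proof (rule tendsto_upperbound)
          show "(\<lambda>l. cmod (dir_deriv (f k) h y - dir_deriv (f l) h y)) \<longlonglongrightarrow> cmod (dir_deriv (f k) h y - D y h)"
            by (intro tendsto_intros conv)
          show "\<forall>\<^sub>F l in sequentially. cmod (dir_deriv (f k) h y - dir_deriv (f l) h y) \<le> e * norm h"
            by (rule eventually_sequentiallyI[of N]) (use N that in simp)
        qed auto
        then show ?thesis unfolding eventually_sequentially by blast
      qed
      show "(\<lambda>k. f k x) \<longlonglongrightarrow> g x" by (rule glim)
    qed auto
    then obtain h where h: "\<And>y. y \<in> ?S \<Longrightarrow> (\<lambda>k. f k y) \<longlonglongrightarrow> h y \<and> (h has_derivative D y) (at y within ?S)"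
      by blast
    have gh: "h y = g y" if "y \<in> ?S" for y
      using h[OF that] glim LIMSEQ_unique by blast
    have "(h has_derivative D x) (at x)"
      using h[of x] at_within_open[of x ?S] by simp
    then show ?thesis
      by (rule has_derivative_transform_within_open[of _ _ _ _ ?S]) (auto simp: gh)
  qed
  show "D x (c *s v) = c * D x v" for x c v
  proof (rule LIMSEQ_unique)
    show "(\<lambda>k. dir_deriv (f k) (c *s v) x) \<longlonglongrightarrow> D x (c *s v)" by (rule conv)
    show "(\<lambda>k. dir_deriv (f k) (c *s v) x) \<longlonglongrightarrow> c * D x v"
      unfolding dir_deriv_scale[OF f] by (intro tendsto_intros conv)
  qed
qed

lemma bounded_on_cball:
  assumes "continuous_on UNIV (f :: 'a::euclidean_space \<Rightarrow> 'b::real_normed_vector)"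
  obtains M where "M > 0" "\<And>x. norm x \<le> R \<Longrightarrow> norm (f x) \<le> M"
proof -
  have "compact (f ` cball 0 R)"
    by (intro compact_continuous_image continuous_on_subset[OF assms]) auto
  then have "\<exists>M>0. \<forall>y\<in>f ` cball 0 R. norm y \<le> M"
    by (simp only: compact_imp_bounded flip: bounded_pos)
  then show ?thesis using that by auto
qed

text \<open>
  A directional derivative is a locally uniform limit of difference quotients; the speed of convergence is controlled by a Cauchy estimate for the second derivative along a line.
\<close>
lemma entire_dir_deriv:
  fixes f :: "complex ^ 'n \<Rightarrow> complex"
  assumes f: "entire f"
  shows "entire (dir_deriv f v)"
proof (rule entire_uniform_limit)
  define h :: "nat \<Rightarrow> complex" where "h k = 1 / of_nat (Suc k)" for k
  define q where "q k x = (f (x + h k *s v) - f x) / h k" for k x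
  have h0: "h k \<noteq> 0" for k by (simp add: h_def del: of_nat_Suc)
  show "entire (q k)" for k unfolding q_def
    by (intro entire_divide entire_diff f entire_compose[OF f]) (simp add: holomorphic_map_def entire_add)
  show "uniform_limit (cball 0 R) q (dir_deriv f v) sequentially" for R
  proof -
    obtain M where M: "M > 0" "\<And>x. norm x \<le> R + 2 * norm v \<Longrightarrow> cmod (f x) \<le> M"
      using bounded_on_cball[OF entire_continuous[OF f]] by blast
    have bound: "cmod (q k x - dir_deriv f v x) \<le> 2 * M * cmod (h k)" if x: "x \<in> cball 0 R" for k x
    proof -
      let ?g = "\<lambda>z. f (x + z *s v)"
      have hol: "?g holomorphic_on S" for S by (rule line_holomorphic[OF f])
      have gM: "cmod (?g z) \<le> M" if "cmod z \<le> 2" for z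
      proof (rule M)
        have "norm (x + z *s v) \<le> norm x + cmod z * norm v"
          using norm_triangle_ineq[of x "z *s v"] by simp
        also have "\<dots> \<le> R + 2 * norm v" using x that by (intro add_mono mult_right_mono) auto
        finally show "norm (x + z *s v) \<le> R + 2 * norm v" .
      qed
      have "cmod ((deriv ^^ 0) ?g (h k) - (\<Sum>i\<le>1. (deriv ^^ i) ?g 0 * (h k - 0) ^ i / fact i))
          \<le> (2 * M) * cmod (h k - 0) ^ Suc 1 / fact 1"
      proof (rule complex_Taylor[where S = "cball 0 1" and f = "\<lambda>i. (deriv ^^ i) ?g"])
        show "((deriv ^^ i) ?g has_field_derivative (deriv ^^ Suc i) ?g z) (at z within cball 0 1)" for i z
          using has_field_derivative_higher_deriv[OF hol open_UNIV UNIV_I]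
          by (rule has_field_derivative_at_within)
        show "cmod ((deriv ^^ Suc 1) ?g z) \<le> 2 * M" if "z \<in> cball 0 1" for z
        proof -
          have "cmod ((deriv ^^ 2) ?g z) \<le> fact 2 * M / 1 ^ 2"
          proof (rule Cauchy_inequality)
            show "?g holomorphic_on ball z 1" "continuous_on (cball z 1) ?g"
              using hol holomorphic_on_imp_continuous_on by blast+
            show "cmod (?g y) \<le> M" if "cmod (z - y) = 1" for y
              using that \<open>z \<in> cball 0 1\<close> norm_triangle_ineq4[of z "z - y"] by (intro gM) simp
          qed auto
          then show ?thesis by (simp add: numeral_2_eq_2)
        qed
        show "h k \<in> cball 0 1" by (simp add: h_def norm_divide del: of_nat_Suc)
      qed auto
      then have "cmod (f (x + h k *s v) - f x - dir_deriv f v x * h k) \<le> 2 * M * cmod (h k) * cmod (h k)"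
        using DERIV_imp_deriv[OF entire_on_line[OF f, of x v 0]] 
        by (simp add: power2_eq_square algebra_simps)
      moreover have "f (x + h k *s v) - f x - dir_deriv f v x * h k = h k * (q k x - dir_deriv f v x)"
        using h0[of k] by (simp add: q_def field_simps)
      ultimately show ?thesis using h0[of k] by (simp add: norm_mult)
    qed
    have "(\<lambda>k. cmod (h k)) \<longlonglongrightarrow> 0"
      unfolding h_def by (intro tendsto_norm_zero lim_1_over_n[THEN LIMSEQ_Suc])
    then have lim0: "(\<lambda>k. 2 * M * cmod (h k)) \<longlonglongrightarrow> 0"
      using tendsto_mult_right_zero by blast
    show ?thesis
    proof (rule uniform_limitI)
      fix e :: real assume "e > 0"
      show "\<forall>\<^sub>F k in sequentially. \<forall>x\<in>cball 0 R. dist (q k x) (dir_deriv f v x) < e"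
        using order_tendstoD(2)[OF lim0 \<open>e > 0\<close>]
      proof eventually_elim
        case (elim k)
        show ?case
        proof
          fix x :: "complex ^ 'n" assume "x \<in> cball 0 R"
          from bound[OF this, of k] elim show "dist (q k x) (dir_deriv f v x) < e"
            by (simp add: dist_norm)
        qed
      qed
    qed
  qed
qed

lemma entire_jacobian_nth:
  fixes g :: "complex ^ 'n \<Rightarrow> complex ^ 'm"
  assumes "holomorphic_map g"
  shows "entire (\<lambda>x. jacobian g (at x) $ i $ j)"
  unfolding jacobian_nth[OF assms] by (intro entire_dir_deriv) (use assms holomorphic_map_def in blast)

section \<open>Vanishing to finite order at the origin\<close>

lemma norm_le_of_derivative_bound:
  fixes f :: "complex ^ 'n \<Rightarrow> complex"
  assumes f: "entire f" and "f 0 = 0"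
    and B: "\<And>y v. norm y \<le> norm x \<Longrightarrow> cmod (dir_deriv f v y) \<le> B * norm v"
  shows "cmod (f x) \<le> B * norm x"
proof -
  have "cmod (f x - f 0) \<le> B * norm (x - 0)"
  proof (rule differentiable_bound[where S = "cball 0 (norm x)"])
    show "(f has_derivative frechet_derivative f (at y)) (at y within cball 0 (norm x))" for y
      by (rule has_derivative_at_withinI) (rule entire_has_derivative[OF f])
    show "onorm (frechet_derivative f (at y)) \<le> B" if "y \<in> cball 0 (norm x)" for y
      using that by (intro onorm_le B) simp
  qed auto
  then show ?thesis using \<open>f 0 = 0\<close> by simp
qed

lemma norm_le_sum_components: "norm (v :: complex ^ 'n) \<le> (\<Sum>i\<in>UNIV. cmod (v $ i))"
  unfolding norm_vec_def by (rule L2_set_le_sum) simp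

primrec word_deriv :: "'n list \<Rightarrow> (complex ^ 'n \<Rightarrow> complex) \<Rightarrow> complex ^ 'n \<Rightarrow> complex" where
  "word_deriv [] f = f"
| "word_deriv (i # w) f = word_deriv w (dir_deriv f (axis i 1))"

lemma dir_deriv_add:
  assumes "entire f" "entire g"
  shows "dir_deriv (\<lambda>x. f x + g x) v x = dir_deriv f v x + dir_deriv g v x"
  by (intro dir_deriv_eq has_derivative_add entire_has_derivative assms)

lemma dir_deriv_cmult:
  assumes "entire f"
  shows "dir_deriv (\<lambda>x. c * f x) v x = c * dir_deriv f v x"
  by (intro dir_deriv_eq has_derivative_mult_right entire_has_derivative assms)

lemma word_deriv_add:
  "entire f \<Longrightarrow> entire g \<Longrightarrow> word_deriv w (\<lambda>x. f x + g x) y = word_deriv w f y + word_deriv w g y"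
  by (induction w arbitrary: f g) (simp_all add: dir_deriv_add entire_dir_deriv)

lemma word_deriv_cmult:
  "entire f \<Longrightarrow> word_deriv w (\<lambda>x. c * f x) y = c * word_deriv w f y"
  by (induction w arbitrary: f) (simp_all add: dir_deriv_cmult entire_dir_deriv)

text \<open>
  A Taylor estimate without Taylor's formula: the order of vanishing is raised one step at a time by the
  mean value inequality. Iterated partial derivatives are indexed by words, so that finitely many linear
  functionals control the order.
\<close>
lemma order_of_vanishing:
  fixes f :: "complex ^ 'n \<Rightarrow> complex"
  assumes "entire f" "\<And>w. length w < k \<Longrightarrow> word_deriv w f 0 = 0"
  shows "\<exists>C\<ge>0. \<forall>x. norm x \<le> R \<longrightarrow> cmod (f x) \<le> C * norm x ^ k"
  using assms
proof (induction k arbitrary: f)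
  case 0
  obtain M where "M > 0" "\<And>x. norm x \<le> R \<Longrightarrow> cmod (f x) \<le> M"
    using bounded_on_cball[OF entire_continuous[OF 0(1)]] by blast
  then show ?case by (intro exI[of _ M]) auto
next
  case (Suc k)
  have "\<exists>C\<ge>0. \<forall>x. norm x \<le> R \<longrightarrow> cmod (dir_deriv f (axis i 1) x) \<le> C * norm x ^ k" for i
  proof (rule Suc.IH)
    show "word_deriv w (dir_deriv f (axis i 1)) 0 = 0" if "length w < k" for w
      using Suc.prems(2)[of "i # w"] that by simp
  qed (rule entire_dir_deriv[OF Suc.prems(1)])
  then obtain C where C: "\<And>i. C i \<ge> 0" 
    "\<And>i x. norm x \<le> R \<Longrightarrow> cmod (dir_deriv f (axis i 1) x) \<le> C i * norm x ^ k"
    by metis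
  have "cmod (f x) \<le> (\<Sum>i\<in>UNIV. C i) * norm x ^ Suc k" if x: "norm x \<le> R" for x
  proof -
    have "cmod (f x) \<le> ((\<Sum>i\<in>UNIV. C i) * norm x ^ k) * norm x"
    proof (rule norm_le_of_derivative_bound)
      show "f 0 = 0" using Suc.prems(2)[of "[]"] by simp
      fix y v :: "complex ^ 'n" assume y: "norm y \<le> norm x"
      have "cmod (dir_deriv f v y) \<le> (\<Sum>i\<in>UNIV. cmod (v $ i * dir_deriv f (axis i 1) y))"
        unfolding dir_deriv_expand[OF Suc.prems(1), of y v] by (rule norm_sum)
      also have "\<dots> \<le> (\<Sum>i\<in>UNIV. norm v * (C i * norm x ^ k))"
      proof (rule sum_mono)
        fix i
        have "cmod (dir_deriv f (axis i 1) y) \<le> C i * norm y ^ k"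
          using C(2) x y by simp
        also have "\<dots> \<le> C i * norm x ^ k"
          by (intro mult_left_mono power_mono y C) auto
        finally show "cmod (v $ i * dir_deriv f (axis i 1) y) \<le> norm v * (C i * norm x ^ k)"
          unfolding norm_mult by (intro mult_mono Finite_Cartesian_Product.norm_nth_le) auto
      qed
      finally show "cmod (dir_deriv f v y) \<le> (\<Sum>i\<in>UNIV. C i) * norm x ^ k * norm v"
        by (simp add: sum_distrib_left sum_distrib_right mult_ac)
    qed (rule Suc.prems(1))
    then show ?thesis by (simp add: mult_ac)
  qed
  then show ?case using C(1) by (intro exI[of _ "\<Sum>i\<in>UNIV. C i"]) (auto intro: sum_nonneg)
qed

section \<open>Decreasing chains seen through finitely many functionals\<close>

text \<open>
  Induction on the functionals: either the first one is nonzero somewhere on every member of the chain, and can be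
  normalised away, or it vanishes on all members from some point on. Finite codimension enters only in this
  form, which avoids bases of quotient spaces.
\<close>
lemma chain_stabilises:
  fixes H :: "nat \<Rightarrow> 'v::ab_group_add set" and scl :: "complex \<Rightarrow> 'v \<Rightarrow> 'v"
    and l :: "'w \<Rightarrow> 'v \<Rightarrow> complex"
  assumes "finite W"
    and l_add: "\<And>w x y. x \<in> V \<Longrightarrow> y \<in> V \<Longrightarrow> l w (x + y) = l w x + l w y"
    and l_scl: "\<And>w c x. x \<in> V \<Longrightarrow> l w (scl c x) = c * l w x"
    and scl_m1: "\<And>x. scl (-1) x = - x"
    and HV: "\<And>j. H j \<subseteq> V" and dec: "\<And>i j. i \<le> j \<Longrightarrow> H j \<subseteq> H i"
    and H_0: "\<And>j. 0 \<in> H j"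
    and H_add: "\<And>j x y. x \<in> H j \<Longrightarrow> y \<in> H j \<Longrightarrow> x + y \<in> H j"
    and H_scl: "\<And>j c x. x \<in> H j \<Longrightarrow> scl c x \<in> H j"
  shows "\<exists>M. \<forall>j\<ge>M. \<forall>x\<in>H M. \<exists>y\<in>H j. \<forall>w\<in>W. l w x = l w y"
  using assms(1) HV dec H_0 H_add H_scl
proof (induction W arbitrary: H)
  case empty
  then show ?case by blast
next
  case (insert u W)
  note HV = insert.prems(1) and dec = insert.prems(2) and H_0 = insert.prems(3)
    and H_add = insert.prems(4) and H_scl = insert.prems(5)
  define K where "K j = {z \<in> H j. l u z = 0}" for j
  obtain M where M: "\<And>j x. j \<ge> M \<Longrightarrow> x \<in> K M \<Longrightarrow> \<exists>y\<in>K j. \<forall>w\<in>W. l w x = l w y"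
  proof -
    have "\<exists>M. \<forall>j\<ge>M. \<forall>x\<in>K M. \<exists>y\<in>K j. \<forall>w\<in>W. l w x = l w y"
    proof (rule insert.IH)
      show "K j \<subseteq> V" for j using HV by (auto simp: K_def)
      show "K j \<subseteq> K i" if "i \<le> j" for i j using dec[OF that] by (auto simp: K_def)
      show "0 \<in> K j" for j
        using H_0[of j] HV[of j] l_add[of 0 0 u] by (auto simp: K_def)
      show "x + y \<in> K j" if "x \<in> K j" "y \<in> K j" for j x y
        using that H_add l_add HV unfolding K_def by (smt (verit, best) add.right_neutral mem_Collect_eq subsetD)
      show "scl c x \<in> K j" if "x \<in> K j" for j c x
        using that H_scl l_scl HV unfolding K_def by (smt (verit, best) mult_zero_right mem_Collect_eq subsetD)
    qed
    then show ?thesis using that by blast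
  qed
  show ?case
  proof (cases "\<forall>j. \<exists>z\<in>H j. l u z \<noteq> 0")
    case True
    have "\<exists>y\<in>H j. \<forall>w\<in>insert u W. l w x = l w y" if j: "j \<ge> M" and x: "x \<in> H M" for j x
    proof -
      from True obtain z where z: "z \<in> H j" "l u z \<noteq> 0" by blast
      define y0 where "y0 = scl (l u x / l u z) z"
      have y0: "y0 \<in> H j" unfolding y0_def by (rule H_scl[OF z(1)])
      then have y0V: "y0 \<in> V" and y0M: "y0 \<in> H M" using HV dec[OF j] by auto
      have ly0: "l u y0 = l u x" unfolding y0_def using z l_scl HV by (metis nonzero_eq_divide_eq subsetD)
      have xV: "x \<in> V" using x HV by blast
      define x1 where "x1 = x + scl (-1) y0"
      have x1H: "x1 \<in> H M" unfolding x1_def by (intro H_add x H_scl y0M)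
      then have x1V: "x1 \<in> V" using HV by blast
      have xx1: "x = x1 + y0" by (simp add: x1_def scl_m1)
      have lx: "l w x = l w x1 + l w y0" for w
        unfolding xx1 by (rule l_add[OF x1V y0V])
      then have "x1 \<in> K M" using x1H ly0 by (simp add: K_def)
      then obtain y1 where y1: "y1 \<in> K j" "\<And>w. w \<in> W \<Longrightarrow> l w x1 = l w y1" using M[OF j] by blast
      then have y1H: "y1 \<in> H j" "l u y1 = 0" by (auto simp: K_def)
      then have y1V: "y1 \<in> V" using HV by blast
      have "\<forall>w\<in>insert u W. l w x = l w (y1 + y0)"
        using lx y1 y1H ly0 l_add[OF y1V y0V] by auto
      then show ?thesis using H_add[OF y1H(1) y0] by blast
    qed
    then show ?thesis by blast
  next
    case False
    then obtain J where J: "\<And>z. z \<in> H J \<Longrightarrow> l u z = 0" by blast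
    have "\<exists>y\<in>H j. \<forall>w\<in>insert u W. l w x = l w y" if j: "j \<ge> max M J" and x: "x \<in> H (max M J)" for j x
    proof -
      have xJ: "l u x = 0" using J dec[of J "max M J"] x by auto
      have "x \<in> K M" using x dec[of M "max M J"] xJ by (auto simp: K_def)
      then obtain y where y: "y \<in> K j" "\<And>w. w \<in> W \<Longrightarrow> l w x = l w y" using M[of j x] j by auto
      then show ?thesis using xJ by (intro bexI[of _ y]) (auto simp: K_def)
    qed
    then show ?thesis by blast
  qed
qed

section \<open>Holomorphic contractions\<close>

locale contraction =
  fixes \<gamma> :: "complex ^ 'n \<Rightarrow> complex ^ 'n"
  assumes contraction: "contraction_at_0 \<gamma>"
begin

lemma bij_contraction: "bij \<gamma>" and hol: "holomorphic_map \<gamma>" and hol_inv: "holomorphic_map (inv \<gamma>)"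
  using contraction unfolding contraction_at_0_def biholomorphism_def by auto

lemma hol_iterate: "holomorphic_map (\<gamma> ^^ j)"
  by (rule holomorphic_map_funpow[OF hol])

lemma iterates_to_0:
  assumes "e > 0"
  obtains N where "\<And>j x. j \<ge> N \<Longrightarrow> norm x \<le> R \<Longrightarrow> norm ((\<gamma> ^^ j) x) < e"
proof -
  have "\<forall>\<^sub>F j in sequentially. (\<gamma> ^^ j) ` cball 0 R \<subseteq> ball 0 e"
    using contraction assms unfolding contraction_at_0_def by auto
  then obtain N where N: "\<And>j. j \<ge> N \<Longrightarrow> (\<gamma> ^^ j) ` cball 0 R \<subseteq> ball 0 e"
    unfolding eventually_sequentially by blast
  show ?thesis
  proof (rule that[of N])
    fix j x assume "j \<ge> N" "norm (x :: complex ^ 'n) \<le> R"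
    then have "(\<gamma> ^^ j) x \<in> ball 0 e"
      using N[of j] by (intro subsetD[OF N[of j]] imageI) auto
    then show "norm ((\<gamma> ^^ j) x) < e" by simp
  qed
qed

lemma orbit_tendsto: "(\<lambda>j. (\<gamma> ^^ j) x) \<longlonglongrightarrow> 0"
proof (rule LIMSEQ_I)
  fix e :: real assume "e > 0"
  then show "\<exists>N. \<forall>j\<ge>N. norm ((\<gamma> ^^ j) x - 0) < e"
    using iterates_to_0[of e "norm x"] by (metis diff_zero order_refl)
qed

lemma fixes_0 [simp]: "\<gamma> 0 = 0"
proof -
  have "(\<lambda>j. \<gamma> ((\<gamma> ^^ j) 0)) \<longlonglongrightarrow> \<gamma> 0"
    using holomorphic_map_continuous[OF hol, of UNIV] orbit_tendsto[of 0]
    by (rule continuous_on_tendsto_compose) auto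
  moreover have "(\<lambda>j. \<gamma> ((\<gamma> ^^ j) 0)) \<longlonglongrightarrow> 0"
    using LIMSEQ_Suc[OF orbit_tendsto[of 0]] by simp
  ultimately show ?thesis using LIMSEQ_unique by blast
qed

lemma iterate_0 [simp]: "(\<gamma> ^^ j) 0 = 0"
  by (induction j) auto

text \<open>Only finitely many iterates of a ball leave the unit ball, so all orbits starting in it stay bounded.\<close>
lemma orbits_bounded:
  obtains M where "M > 0" "\<And>j x. norm x \<le> R \<Longrightarrow> norm ((\<gamma> ^^ j) x) \<le> M"
proof -
  obtain N where N: "\<And>j x. j \<ge> N \<Longrightarrow> norm x \<le> R \<Longrightarrow> norm ((\<gamma> ^^ j) x) < 1"
    using iterates_to_0[of 1 R] by auto
  have "\<exists>M>0. \<forall>j<k. \<forall>x. norm x \<le> R \<longrightarrow> norm ((\<gamma> ^^ j) x) \<le> M" for k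
  proof (induction k)
    case 0 show ?case by (intro exI[of _ 1]) auto
  next
    case (Suc k)
    then obtain M where M: "M > 0" "\<And>j x. j < k \<Longrightarrow> norm x \<le> R \<Longrightarrow> norm ((\<gamma> ^^ j) x) \<le> M" by blast
    obtain M' where "M' > 0" "\<And>x. norm x \<le> R \<Longrightarrow> norm ((\<gamma> ^^ k) x) \<le> M'"
      using bounded_on_cball[OF holomorphic_map_continuous[OF hol_iterate]] by blast
    with M show ?case 
      by (intro exI[of _ "max M M'"]) (auto simp: less_Suc_eq le_max_iff_disj)
  qed
  from this[of N] obtain M where M: "M > 0" "\<And>j x. j < N \<Longrightarrow> norm x \<le> R \<Longrightarrow> norm ((\<gamma> ^^ j) x) \<le> M" by blast
  show ?thesis
  proof (rule that[of "max M 1"])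
    fix j x assume "norm (x :: complex ^ 'n) \<le> R"
    then show "norm ((\<gamma> ^^ j) x) \<le> max M 1"
      using M(2)[of j x] N[of j x] by (cases "j < N") auto
  qed simp
qed

text \<open>
  In the given norm \<open>\<gamma>\<close> itself may expand near \<open>0\<close>, but some iterate does not: an iterate that is uniformly small on
  the ball of radius two has small derivative on the unit ball.
\<close>
lemma some_iterate_halves:
  obtains N where "N > 0" "\<And>x. norm x \<le> 1 \<Longrightarrow> norm ((\<gamma> ^^ N) x) \<le> 1 / 2 * norm x"
proof -
  define e :: real where "e = 1 / (2 * CARD('n))"
  have e: "e > 0" by (simp add: e_def)
  obtain N0 where N0: "\<And>j x. j \<ge> N0 \<Longrightarrow> norm x \<le> 2 \<Longrightarrow> norm ((\<gamma> ^^ j) x) < e"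
    using iterates_to_0[OF e, of 2] by blast
  have "norm ((\<gamma> ^^ Suc N0) x) \<le> 1 / 2 * norm x" if x: "norm x \<le> 1" for x
  proof -
    have "cmod ((\<gamma> ^^ Suc N0) x $ i) \<le> e * norm x" for i
    proof (rule norm_le_of_derivative_bound)
      show ent: "entire (\<lambda>x. (\<gamma> ^^ Suc N0) x $ i)" using hol_iterate holomorphic_map_def by blast
      show "(\<gamma> ^^ Suc N0) 0 $ i = 0" unfolding iterate_0 by simp
      fix y v :: "complex ^ 'n" assume "norm y \<le> norm x"
      have "cmod (dir_deriv (\<lambda>x. (\<gamma> ^^ Suc N0) x $ i) v y) \<le> e * norm v / 1"
      proof (rule Cauchy_estimate_dir_deriv[OF ent])
        fix z assume "z \<in> cball y 1"
        then have "norm z \<le> 2"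
          using \<open>norm y \<le> norm x\<close> x norm_triangle_sub[of z y] by (simp add: dist_norm norm_minus_commute)
        then show "cmod ((\<gamma> ^^ Suc N0) z $ i) \<le> e"
          using N0[of "Suc N0" z] Finite_Cartesian_Product.norm_nth_le[of "(\<gamma> ^^ Suc N0) z" i] by linarith
      qed auto
      then show "cmod (dir_deriv (\<lambda>x. (\<gamma> ^^ Suc N0) x $ i) v y) \<le> e * norm v" by simp
    qed
    then have "(\<Sum>i\<in>UNIV. cmod ((\<gamma> ^^ Suc N0) x $ i)) \<le> (\<Sum>i\<in>(UNIV :: 'n set). e * norm x)"
      by (intro sum_mono) blast
    also have "\<dots> = 1 / 2 * norm x" by (simp add: e_def)
    finally show ?thesis using norm_le_sum_components order_trans by blast
  qed
  then show ?thesis using that[of "Suc N0"] by blast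
qed

text \<open>
  The rate \<open>\<rho>\<close> is independent of \<open>R\<close>, since every orbit ends up in the unit ball. This uniformity is what allows
  one order of vanishing to serve for all balls later.
\<close>
lemma geometric_decay:
  obtains \<rho> where "0 < \<rho>" "\<rho> < 1"
    "\<And>R. \<exists>C>0. \<forall>j x. norm x \<le> R \<longrightarrow> norm ((\<gamma> ^^ j) x) \<le> C * \<rho> ^ j"
proof -
  obtain N where N: "N > 0" "\<And>x. norm x \<le> 1 \<Longrightarrow> norm ((\<gamma> ^^ N) x) \<le> 1 / 2 * norm x"
    using some_iterate_halves by blast
  \<comment> \<open>one step counts as the \<open>N\<close>-th part of a halving\<close>
  define \<rho> where "\<rho> = root N (1 / 2)"
  have \<rho>: "0 < \<rho>" "\<rho> < 1" "\<rho> ^ N = 1 / 2"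
    unfolding \<rho>_def using N(1) by (auto simp: real_root_lt_1_iff)
  have "\<exists>C>0. \<forall>j x. norm x \<le> R \<longrightarrow> norm ((\<gamma> ^^ j) x) \<le> C * \<rho> ^ j" for R
  proof -
    obtain M where M: "M > 0" "\<And>j x. norm x \<le> R \<Longrightarrow> norm ((\<gamma> ^^ j) x) \<le> M"
      using orbits_bounded by blast
    obtain J where J: "\<And>j x. j \<ge> J \<Longrightarrow> norm x \<le> R \<Longrightarrow> norm ((\<gamma> ^^ j) x) < 1"
      using iterates_to_0[of 1 R] by auto
    define C where "C = M / \<rho> ^ (J + N)"
    have "norm ((\<gamma> ^^ j) x) \<le> C * \<rho> ^ j" if x: "norm x \<le> R" for j x
    proof (induction j rule: less_induct)
      case (less j)
      show ?case
      proof (cases "j < J + N")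
        case True
        have "M = C * \<rho> ^ (J + N)" using \<rho> by (simp add: C_def)
        also have "\<dots> \<le> C * \<rho> ^ j"
          using True \<rho> M(1) by (intro mult_left_mono power_decreasing) (auto simp: C_def)
        finally show ?thesis using M(2)[OF x, of j] by linarith
      next
        case False
        have "norm ((\<gamma> ^^ (N + (j - N))) x) \<le> 1 / 2 * norm ((\<gamma> ^^ (j - N)) x)"
          unfolding funpow_add comp_def using False J[of "j - N", OF _ x] by (intro N(2)) linarith
        also have "\<dots> \<le> \<rho> ^ N * (C * \<rho> ^ (j - N))"
          unfolding \<rho>(3) using less[of "j - N"] False N(1) by simp
        also have "\<dots> = C * \<rho> ^ (N + (j - N))" by (simp add: power_add)
        finally show ?thesis using False by simp
      qed
    qed
    moreover have "C > 0" using M(1) \<rho> by (simp add: C_def)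
    ultimately show ?thesis by blast
  qed
  then show ?thesis using that \<rho> by blast
qed

end

section \<open>Transfer operators over a contraction\<close>

text \<open>
  One operator covers three cases. With \<open>B\<close> the inverse of the Jacobian of \<open>\<gamma>\<close> it is the pull-back of vector fields;
  with \<open>B\<close> the transposed Jacobian it is the pull-back of \<open>1\<close>-forms. A field is killed by a power of
  \<open>transfer - \<mu>\<close> exactly if it is a generalised eigenvector for \<open>\<mu>\<close>.
\<close>
definition transfer ::
  "('a \<Rightarrow> 'a) \<Rightarrow> ('a \<Rightarrow> complex ^ 'm ^ 'm) \<Rightarrow> ('a \<Rightarrow> complex ^ 'm) \<Rightarrow> 'a \<Rightarrow> complex ^ 'm" where
  "transfer \<gamma> B X = (\<lambda>x. B x *v X (\<gamma> x))"

definition shifted ::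
  "('a \<Rightarrow> 'a) \<Rightarrow> ('a \<Rightarrow> complex ^ 'm ^ 'm) \<Rightarrow> complex \<Rightarrow> ('a \<Rightarrow> complex ^ 'm) \<Rightarrow> 'a \<Rightarrow> complex ^ 'm" where
  "shifted \<gamma> B \<mu> X = (\<lambda>x. transfer \<gamma> B X x - \<mu> *s X x)"

definition field_scale :: "complex \<Rightarrow> ('a \<Rightarrow> complex ^ 'm) \<Rightarrow> 'a \<Rightarrow> complex ^ 'm" where
  "field_scale c X = (\<lambda>x. c *s X x)"

lemma shifted_add: "shifted \<gamma> B \<mu> (X + Y) = shifted \<gamma> B \<mu> X + shifted \<gamma> B \<mu> Y"
  by (simp add: shifted_def transfer_def fun_eq_iff matrix_vector_right_distrib vector_add_ldistrib)

lemma shifted_diff: "shifted \<gamma> B \<mu> (X - Y) = shifted \<gamma> B \<mu> X - shifted \<gamma> B \<mu> Y"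
  by (simp add: shifted_def transfer_def fun_eq_iff matrix_vector_mult_diff_distrib vector_ssub_ldistrib)

lemma shifted_scale: "shifted \<gamma> B \<mu> (field_scale c X) = field_scale c (shifted \<gamma> B \<mu> X)"
  by (simp add: shifted_def transfer_def field_scale_def fun_eq_iff vec.scale vector_ssub_ldistrib
      vector_smult_assoc mult.commute)

lemma shifted_zero: "shifted \<gamma> B \<mu> 0 = 0"
  by (simp add: shifted_def transfer_def fun_eq_iff)

lemma shifted_funpow_add: "(shifted \<gamma> B \<mu> ^^ N) (X + Y) = (shifted \<gamma> B \<mu> ^^ N) X + (shifted \<gamma> B \<mu> ^^ N) Y"
  by (induction N) (simp_all only: funpow.simps comp_def id_apply shifted_add)

lemma shifted_funpow_diff: "(shifted \<gamma> B \<mu> ^^ N) (X - Y) = (shifted \<gamma> B \<mu> ^^ N) X - (shifted \<gamma> B \<mu> ^^ N) Y"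
  by (induction N) (simp_all only: funpow.simps comp_def id_apply shifted_diff)

lemma shifted_funpow_scale: "(shifted \<gamma> B \<mu> ^^ N) (field_scale c X) = field_scale c ((shifted \<gamma> B \<mu> ^^ N) X)"
  by (induction N) (simp_all only: funpow.simps comp_def id_apply shifted_scale)

lemma shifted_funpow_zero: "(shifted \<gamma> B \<mu> ^^ N) 0 = 0"
  by (induction N) (simp_all only: funpow.simps comp_def id_apply shifted_zero)

lemma holomorphic_map_add: "holomorphic_map X \<Longrightarrow> holomorphic_map Y \<Longrightarrow> holomorphic_map (X + Y)"
  by (simp add: holomorphic_map_def entire_add)

lemma holomorphic_map_diff: "holomorphic_map X \<Longrightarrow> holomorphic_map Y \<Longrightarrow> holomorphic_map (X - Y)"
  by (simp add: holomorphic_map_def entire_diff)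

lemma holomorphic_map_scale: "holomorphic_map X \<Longrightarrow> holomorphic_map (field_scale c X)"
  by (simp add: holomorphic_map_def field_scale_def entire_cmult)

lemma holomorphic_map_matrix_vector:
  assumes "\<And>i j. entire (\<lambda>x. B x $ i $ j)" "holomorphic_map X"
  shows "holomorphic_map (\<lambda>x. B x *v X x)"
  using assms unfolding holomorphic_map_def matrix_vector_mult_def
  by (auto intro!: entire_sum entire_mult)

locale contraction_cocycle = contraction \<gamma> for \<gamma> :: "complex ^ 'n \<Rightarrow> complex ^ 'n" +
  fixes B :: "complex ^ 'n \<Rightarrow> complex ^ 'm ^ 'm"
  assumes entire_cocycle: "\<And>i j. entire (\<lambda>x. B x $ i $ j)"
begin

abbreviation "T \<equiv> transfer \<gamma> B"

abbreviation "S \<equiv> shifted \<gamma> B"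

lemma holomorphic_transfer: "holomorphic_map X \<Longrightarrow> holomorphic_map (T X)"
  unfolding transfer_def
  by (intro holomorphic_map_matrix_vector entire_cocycle holomorphic_map_compose[of X \<gamma>] hol)

lemma holomorphic_transfer_funpow: "holomorphic_map X \<Longrightarrow> holomorphic_map ((T ^^ j) X)"
  by (induction j) (auto intro: holomorphic_transfer)

lemma holomorphic_shifted:
  assumes "holomorphic_map X" shows "holomorphic_map (S \<mu> X)"
  using holomorphic_map_diff[OF holomorphic_transfer[OF assms] holomorphic_map_scale[OF assms, of \<mu>]]
  by (simp add: shifted_def field_scale_def fun_diff_def)

text \<open>
  Along an orbit all but finitely many factors of the cocycle are evaluated in the unit ball. Hence the
  exponential growth rate \<open>b\<close> of the cocycle does not depend on the ball in which the orbits start.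
\<close>
lemma cocycle_growth:
  obtains b where "b \<ge> 1"
    "\<And>R. \<exists>C>0. \<forall>j x Y. norm x \<le> R \<longrightarrow> norm ((T ^^ j) Y x) \<le> C * b ^ j * norm (Y ((\<gamma> ^^ j) x))"
proof -
  define \<beta> where "\<beta> y = (\<Sum>i\<in>UNIV. \<Sum>k\<in>UNIV. cmod (B y $ i $ k))" for y
  have \<beta>: "norm (B y *v v) \<le> \<beta> y * norm v" for y v
  proof -
    have "norm (B y *v v) \<le> (\<Sum>i\<in>UNIV. \<Sum>k\<in>UNIV. cmod (B y $ i $ k) * norm v)"
      by (rule order_trans[OF norm_le_sum_components])
        (auto simp: matrix_vector_mult_def norm_mult
          intro!: sum_mono order_trans[OF norm_sum] mult_left_mono Finite_Cartesian_Product.norm_nth_le)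
    then show ?thesis by (simp add: \<beta>_def sum_distrib_right)
  qed
  have \<beta>0: "\<beta> y \<ge> 0" for y by (simp add: \<beta>_def sum_nonneg)
  have \<beta>_cont: "continuous_on UNIV \<beta>" unfolding \<beta>_def
    by (intro continuous_intros entire_continuous entire_cocycle)
  obtain b0 where b0: "\<And>y. norm y \<le> 1 \<Longrightarrow> norm (\<beta> y) \<le> b0" using bounded_on_cball[OF \<beta>_cont] by blast
  define b where "b = max b0 1"
  have b1: "b \<ge> 1" and b: "\<And>y. norm y \<le> 1 \<Longrightarrow> \<beta> y \<le> b"
    using b0 \<beta>0 by (force simp: b_def)+
  have "\<exists>C>0. \<forall>j x Y. norm x \<le> R \<longrightarrow> norm ((T ^^ j) Y x) \<le> C * b ^ j * norm (Y ((\<gamma> ^^ j) x))" for R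
  proof -
    obtain R' where R': "\<And>j x. norm x \<le> R \<Longrightarrow> norm ((\<gamma> ^^ j) x) \<le> R'" using orbits_bounded by blast
    obtain M0 where M0: "\<And>y. norm y \<le> R' \<Longrightarrow> norm (\<beta> y) \<le> M0" using bounded_on_cball[OF \<beta>_cont] by blast
    define M where "M = max M0 1"
    have M1: "M \<ge> 1" and M: "\<And>y. norm y \<le> R' \<Longrightarrow> \<beta> y \<le> M"
      using M0 \<beta>0 by (force simp: M_def)+
    obtain J where J: "\<And>j x. j \<ge> J \<Longrightarrow> norm x \<le> R \<Longrightarrow> norm ((\<gamma> ^^ j) x) < 1"
      using iterates_to_0[of 1 R] by auto
    have claim: "norm ((T ^^ j) Y x) \<le> M ^ min j J * b ^ j * norm (Y ((\<gamma> ^^ j) x))"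
      if x: "norm x \<le> R" for j x Y
    proof (induction j arbitrary: Y)
      case 0 show ?case by simp
    next
      case (Suc j)
      let ?y = "(\<gamma> ^^ j) x"
      have step: "M ^ min j J * b ^ j * \<beta> ?y \<le> M ^ min (Suc j) J * b ^ Suc j"
      proof (cases "j < J")
        case True
        have "\<beta> ?y \<le> M * b" 
          using M[OF R'[OF x, of j]] b1 M1 by (metis mult.right_neutral mult_left_mono order_trans zero_le_one)
        then have "M ^ j * b ^ j * \<beta> ?y \<le> M ^ j * b ^ j * (M * b)"
          using b1 M1 by (intro mult_left_mono) auto
        then show ?thesis using True by (simp add: mult_ac)
      next
        case False
        have "\<beta> ?y \<le> b" using b J[of j x] x False by (simp add: less_imp_le)
        then have "M ^ J * b ^ j * \<beta> ?y \<le> M ^ J * b ^ j * b"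
          using b1 M1 by (intro mult_left_mono) auto
        then show ?thesis using False by (simp add: mult_ac)
      qed
      have "norm ((T ^^ Suc j) Y x) = norm ((T ^^ j) (T Y) x)" by (simp add: funpow_swap1)
      also have "\<dots> \<le> M ^ min j J * b ^ j * norm (T Y ?y)" by (rule Suc)
      also have "\<dots> \<le> M ^ min j J * b ^ j * (\<beta> ?y * norm (Y ((\<gamma> ^^ Suc j) x)))"
        unfolding transfer_def using b1 M1 \<beta> by (intro mult_left_mono) auto
      also have "\<dots> \<le> M ^ min (Suc j) J * b ^ Suc j * norm (Y ((\<gamma> ^^ Suc j) x))"
        using mult_right_mono[OF step norm_ge_zero] by (simp add: mult.assoc)
      finally show ?case .
    qed
    have "norm ((T ^^ j) Y x) \<le> M ^ J * b ^ j * norm (Y ((\<gamma> ^^ j) x))" if x: "norm x \<le> R" for j x Y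
      using b1 M1 by (intro order_trans[OF claim[OF x]] mult_right_mono power_increasing) auto
    then show ?thesis using M1 by (intro exI[of _ "M ^ J"]) auto
  qed
  then show ?thesis using that b1 by blast
qed

text \<open>
  The condition is on the iterates of the operator rather than on the order of vanishing at \<open>0\<close>, because in this
  form it is visibly inherited by the sum of a Neumann series.
\<close>
definition decaying :: "real \<Rightarrow> (complex ^ 'n \<Rightarrow> complex ^ 'm) set" where
  "decaying q = {Y. holomorphic_map Y \<and> Y 0 = 0 \<and>
     (\<forall>R. \<exists>C. \<forall>j x. norm x \<le> R \<longrightarrow> norm ((T ^^ j) Y x) \<le> C * q ^ j)}"

text \<open>
  Vanishing to high order beats the growth of the cocycle: if \<open>\<gamma>\<close> contracts at rate \<open>\<rho>\<close>, then
  vanishing to order \<open>k\<close> gives decay at rate \<open>b \<rho>\<^sup>k\<close>.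
\<close>
lemma high_order_decays:
  assumes "q > 0"
  obtains k where "\<And>Y. holomorphic_map Y \<Longrightarrow> (\<And>w i. length w < k \<Longrightarrow> word_deriv w (\<lambda>x. Y x $ i) 0 = 0)
      \<Longrightarrow> Y \<in> decaying q"
proof -
  obtain b where b: "b \<ge> 1" 
    "\<And>R. \<exists>C>0. \<forall>j x Y. norm x \<le> R \<longrightarrow> norm ((T ^^ j) Y x) \<le> C * b ^ j * norm (Y ((\<gamma> ^^ j) x))"
    using cocycle_growth by blast
  obtain \<rho> where \<rho>: "0 < \<rho>" "\<rho> < 1"
    "\<And>R. \<exists>C>0. \<forall>j x. norm x \<le> R \<longrightarrow> norm ((\<gamma> ^^ j) x) \<le> C * \<rho> ^ j"
    using geometric_decay by blast
  obtain k0 where "\<rho> ^ k0 < q / b"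
    using real_arch_pow_inv[of "q / b" \<rho>] assms b \<rho> by auto
  then have k0: "b * \<rho> ^ k0 < q" using b by (simp add: field_simps)
  define k where "k = Suc k0"
  have "b * \<rho> ^ k \<le> b * \<rho> ^ k0"
    unfolding k_def using \<rho> b by (intro mult_left_mono power_decreasing) auto
  with k0 have k: "b * \<rho> ^ k \<le> q" by simp
  show ?thesis
  proof (rule that[of k])
    fix Y :: "complex ^ 'n \<Rightarrow> complex ^ 'm"
    assume Y: "holomorphic_map Y" and van: "\<And>w i. length w < k \<Longrightarrow> word_deriv w (\<lambda>x. Y x $ i) 0 = 0"
    have Y_ent: "entire (\<lambda>x. Y x $ i)" for i using Y holomorphic_map_def by blast
    have "Y 0 = 0" using van[of "[]"] by (simp add: vec_eq_iff k_def)
    moreover have "\<exists>C. \<forall>j x. norm x \<le> R \<longrightarrow> norm ((T ^^ j) Y x) \<le> C * q ^ j" for R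
    proof -
      obtain R' where R': "\<And>j x. norm x \<le> R \<Longrightarrow> norm ((\<gamma> ^^ j) x) \<le> R'" using orbits_bounded by blast
      obtain D where D: "D > 0" "\<And>j x. norm x \<le> R \<Longrightarrow> norm ((\<gamma> ^^ j) x) \<le> D * \<rho> ^ j"
        using \<rho>(3) by blast
      obtain C where C: "C > 0" 
        "\<And>j x Y. norm x \<le> R \<Longrightarrow> norm ((T ^^ j) Y x) \<le> C * b ^ j * norm (Y ((\<gamma> ^^ j) x))"
        using b(2) by blast
      have "\<exists>C\<ge>0. \<forall>x. norm x \<le> R' \<longrightarrow> cmod (Y x $ i) \<le> C * norm x ^ k" for i
        by (rule order_of_vanishing[OF Y_ent]) (rule van)
      then obtain c where c: "\<And>i. c i \<ge> 0" "\<And>i x. norm x \<le> R' \<Longrightarrow> cmod (Y x $ i) \<le> c i * norm x ^ k"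
        by metis
      define E where "E = (\<Sum>i\<in>UNIV. c i)"
      have E0: "E \<ge> 0" unfolding E_def using c(1) by (simp add: sum_nonneg)
      have E: "norm (Y x) \<le> E * norm x ^ k" if "norm x \<le> R'" for x
        unfolding E_def sum_distrib_right
        by (rule order_trans[OF norm_le_sum_components]) (intro sum_mono c that)
      have "norm ((T ^^ j) Y x) \<le> (C * E * D ^ k) * q ^ j" if x: "norm x \<le> R" for j x
      proof -
        have "norm ((T ^^ j) Y x) \<le> C * b ^ j * norm (Y ((\<gamma> ^^ j) x))" by (rule C(2)[OF x])
        also have "\<dots> \<le> C * b ^ j * (E * (D * \<rho> ^ j) ^ k)"
          using E[OF R'[OF x, of j]] D(2)[OF x, of j] E0 b(1) C(1)
          by (intro mult_left_mono order_trans[OF E[OF R'[OF x]]] power_mono) auto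
        also have "\<dots> = (C * E * D ^ k) * (b * \<rho> ^ k) ^ j"
          by (simp add: power_mult_distrib power_mult[symmetric] mult_ac)
        also have "\<dots> \<le> (C * E * D ^ k) * q ^ j"
          using k b(1) \<rho>(1) E0 C(1) D(1) by (intro mult_left_mono power_mono) auto
        finally show ?thesis .
      qed
      then show ?thesis by blast
    qed
    ultimately show "Y \<in> decaying q" using Y unfolding decaying_def by blast
  qed
qed

lemma transfer_sums:
  assumes "\<And>x. (\<lambda>i. u i x) sums Z x"
  shows "(\<lambda>i. T (u i) x) sums T Z x"
  unfolding transfer_def using bounded_linear.sums[OF _ assms] matrix_vector_mul_bounded_linear by blast

lemma transfer_funpow_sums:
  assumes "\<And>x. (\<lambda>i. u i x) sums Z x"
  shows "(\<lambda>i. (T ^^ j) (u i) x) sums (T ^^ j) Z x"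
  by (induction j arbitrary: x) (simp_all add: assms transfer_sums)

lemma transfer_funpow_scale: "(T ^^ j) (\<lambda>x. c *s Y x) x = c *s (T ^^ j) Y x"
proof (induction j arbitrary: x)
  case (Suc j)
  then have "(T ^^ j) (\<lambda>x. c *s Y x) = (\<lambda>x. c *s (T ^^ j) Y x)" by blast
  then show ?case
    by (simp add: transfer_def[of _ _ "(T ^^ j) Y"] transfer_def[of _ _ "\<lambda>x. c *s (T ^^ j) Y x"] vec.scale)
qed simp

text \<open>On rapidly decaying fields, \<open>T - \<mu>\<close> is inverted by the Neumann series \<open>- \<Sum>\<^sub>i \<mu>\<^bsup>-i-1\<^esup> T\<^sup>i\<close>.\<close>
lemma shifted_onto_decaying:
  assumes q: "0 < q" "q < cmod \<mu>" and Y: "Y \<in> decaying q"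
  shows "\<exists>Z\<in>decaying q. S \<mu> Z = Y"
proof -
  have \<mu>0: "\<mu> \<noteq> 0" using q by auto
  define u where "u i x = (- 1 / \<mu> ^ Suc i) *s (T ^^ i) Y x" for i x
  define a where "a = q / cmod \<mu>"
  have a: "0 < a" "a < 1" using q \<mu>0 by (auto simp: a_def divide_less_eq)
  have Yh: "holomorphic_map Y" and Y0: "Y 0 = 0" using Y unfolding decaying_def by auto
  have Y_bd: "\<exists>C. \<forall>j x. norm x \<le> R \<longrightarrow> norm ((T ^^ j) Y x) \<le> C * q ^ j" for R
    using Y unfolding decaying_def by auto
  have u_bd: "norm ((T ^^ j) (u i) x) \<le> C * q ^ j / cmod \<mu> * a ^ i"
    if C: "\<And>j x. norm x \<le> R \<Longrightarrow> norm ((T ^^ j) Y x) \<le> C * q ^ j" and x: "norm x \<le> R" for C R i j x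
  proof -
    have "(T ^^ j) (u i) x = (- 1 / \<mu> ^ Suc i) *s (T ^^ (j + i)) Y x"
      unfolding u_def transfer_funpow_scale by (simp add: funpow_add)
    then have "norm ((T ^^ j) (u i) x) = norm ((T ^^ (j + i)) Y x) / cmod \<mu> ^ Suc i"
      by (simp add: norm_divide norm_power norm_mult)
    also have "\<dots> \<le> C * q ^ (j + i) / cmod \<mu> ^ Suc i"
      by (intro divide_right_mono C x) simp
    also have "\<dots> = C * q ^ j / cmod \<mu> * a ^ i"
      by (simp add: a_def power_add power_divide)
    finally show ?thesis .
  qed
  have summ: "summable (\<lambda>i. c * a ^ i)" for c :: real using a by (intro summable_mult summable_geometric) simp
  define Z where "Z x = (\<Sum>i. u i x)" for x
  have unif: "uniform_limit (cball 0 R) (\<lambda>k x. \<Sum>i<k. u i x) Z sequentially" for R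
  proof -
    obtain C where C: "\<And>j x. norm x \<le> R \<Longrightarrow> norm ((T ^^ j) Y x) \<le> C * q ^ j" using Y_bd[of R] by blast
    show ?thesis unfolding Z_def
      by (rule Weierstrass_m_test[OF _ summ[of "C / cmod \<mu>"]]) (use u_bd[OF C, of _ _ 0] in simp)
  qed
  have sums: "(\<lambda>i. u i x) sums Z x" for x
    using tendsto_uniform_limitI[OF unif[of "norm x"], of x] by (simp add: sums_def)
  have u_hol: "holomorphic_map (u i)" for i
    using holomorphic_map_scale[OF holomorphic_transfer_funpow[OF Yh]]
    unfolding u_def field_scale_def by blast
  have "holomorphic_map Z"
    unfolding holomorphic_map_def
  proof
    fix l
    show "entire (\<lambda>x. Z x $ l)"
    proof (rule entire_uniform_limit)
      show "entire (\<lambda>x. (\<Sum>i<k. u i x) $ l)" for k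
        using u_hol unfolding holomorphic_map_def by (auto intro: entire_sum)
      show "uniform_limit (cball 0 R) (\<lambda>k x. (\<Sum>i<k. u i x) $ l) (\<lambda>x. Z x $ l) sequentially" for R
        by (rule bounded_linear.uniform_limit[OF bounded_linear_vec_nth unif])
    qed
  qed
  moreover have "Z 0 = 0"
  proof -
    have "(T ^^ i) Y 0 = 0" for i
      by (induction i) (simp_all add: Y0 transfer_def)
    then show ?thesis by (simp add: Z_def u_def)
  qed
  moreover have "\<exists>C. \<forall>j x. norm x \<le> R \<longrightarrow> norm ((T ^^ j) Z x) \<le> C * q ^ j" for R
  proof -
    obtain C where C: "\<And>j x. norm x \<le> R \<Longrightarrow> norm ((T ^^ j) Y x) \<le> C * q ^ j" using Y_bd[of R] by blast
    have "norm ((T ^^ j) Z x) \<le> (\<Sum>i. C / cmod \<mu> * a ^ i) * q ^ j" if x: "norm x \<le> R" for j x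
    proof -
      have "(T ^^ j) Z x = (\<Sum>i. (T ^^ j) (u i) x)"
        by (rule sums_unique[OF transfer_funpow_sums[OF sums]])
      also have "norm \<dots> \<le> (\<Sum>i. C * q ^ j / cmod \<mu> * a ^ i)"
        by (intro norm_suminf_le summ u_bd[OF C x])
      also have "\<dots> = (\<Sum>i. C / cmod \<mu> * a ^ i * q ^ j)" by (simp add: mult_ac)
      also have "\<dots> = (\<Sum>i. C / cmod \<mu> * a ^ i) * q ^ j" by (rule suminf_mult2[symmetric, OF summ])
      finally show ?thesis .
    qed
    then show ?thesis by blast
  qed
  ultimately have "Z \<in> decaying q" unfolding decaying_def by blast
  moreover have "S \<mu> Z = Y"
  proof
    fix x
    have "(\<lambda>i. \<mu> *s u (Suc i) x) sums T Z x"
    proof -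
      have "T (u i) x = \<mu> *s u (Suc i) x" for i
      proof -
        have "T (u i) x = (- 1 / \<mu> ^ Suc i) *s (T ^^ Suc i) Y x"
          using transfer_funpow_scale[of 1 _ "(T ^^ i) Y"]
          unfolding u_def by (simp only: funpow.simps comp_def id_apply One_nat_def)
        also have "\<dots> = \<mu> *s u (Suc i) x"
          using \<mu>0 by (simp add: u_def vector_smult_assoc)
        finally show ?thesis .
      qed
      moreover have "(\<lambda>i. T (u i) x) sums T Z x" by (rule transfer_sums) (rule sums)
      ultimately show ?thesis by simp
    qed
    moreover have "(\<lambda>i. \<mu> *s u (Suc i) x) sums (\<mu> *s (Z x - u 0 x))"
    proof -
      have "bounded_linear (\<lambda>v. \<mu> *s (v :: complex ^ 'm))"
        by (simp add: linear_iff vec_eq_iff distrib_left flip: linear_conv_bounded_linear)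
      moreover have "(\<lambda>i. u (Suc i) x) sums (Z x - u 0 x)"
        using sums_Suc_iff[of "\<lambda>i. u i x"] sums[of x] by simp
      ultimately show ?thesis by (rule bounded_linear.sums)
    qed
    ultimately have "T Z x = \<mu> *s (Z x - u 0 x)" by (rule sums_unique2)
    then show "S \<mu> Z x = Y x" using \<mu>0
      by (simp add: shifted_def u_def vector_ssub_ldistrib vector_smult_assoc)
  qed
  ultimately show ?thesis by blast
qed

text \<open>
  Existence of generalised eigenfields with prescribed value at the fixed point. The constant field \<open>v\<close> is
  a generalised eigenfield modulo the space \<open>F\<close> of fields vanishing at \<open>0\<close>. Since \<open>F\<close> consists of rapidly
  decaying fields up to finite codimension, and \<open>S = T - \<mu>\<close> maps the decaying fields onto themselves,
  the chain \<open>S\<^sup>j F\<close> becomes stationary, and a correction in \<open>F\<close> can be chosen as in the Fitting lemma.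
\<close>
lemma generalised_eigenfield:
  assumes \<mu>: "\<mu> \<noteq> 0" and v: "((\<lambda>u. B 0 *v u - \<mu> *s u) ^^ N) v = 0"
  shows "\<exists>X M. holomorphic_map X \<and> X 0 = v \<and> (S \<mu> ^^ M) X = 0"
proof -
  define q where "q = cmod \<mu> / 2"
  have q: "0 < q" "q < cmod \<mu>" using \<mu> by (auto simp: q_def)
  obtain k where k: "\<And>Y. holomorphic_map Y \<Longrightarrow> (\<And>w i. length w < k \<Longrightarrow> word_deriv w (\<lambda>x. Y x $ i) 0 = 0)
      \<Longrightarrow> Y \<in> decaying q"
    using high_order_decays[OF q(1)] by blast
  define F where "F = {X :: complex ^ 'n \<Rightarrow> complex ^ 'm. holomorphic_map X \<and> X 0 = 0}"
  define H where "H j = (S \<mu> ^^ j) ` F" for j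
  have SF: "S \<mu> X \<in> F" if "X \<in> F" for X
    using that holomorphic_shifted by (auto simp: F_def shifted_def transfer_def)
  have SnF: "(S \<mu> ^^ j) X \<in> F" if "X \<in> F" for j X
    using that by (induction j) (auto intro: SF)
  have dec: "H j \<subseteq> H i" if "i \<le> j" for i j
  proof
    fix Y assume "Y \<in> H j"
    then obtain X where X: "X \<in> F" "Y = (S \<mu> ^^ j) X" unfolding H_def by blast
    have "Y = (S \<mu> ^^ i) ((S \<mu> ^^ (j - i)) X)"
      using that by (simp add: X(2) comp_def flip: funpow_add[THEN fun_cong, unfolded comp_def])
    then show "Y \<in> H i" unfolding H_def using SnF[OF X(1)] by blast
  qed
  have dec_onto: "\<exists>Z\<in>decaying q. (S \<mu> ^^ j) Z = Y" if "Y \<in> decaying q" for j Y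
    using that
  proof (induction j arbitrary: Y)
    case 0 then show ?case by auto
  next
    case (Suc j)
    from shifted_onto_decaying[OF q Suc.prems] obtain Y' where Y': "Y' \<in> decaying q" "S \<mu> Y' = Y" by blast
    with Suc.IH[OF Y'(1)] show ?case by auto
  qed
  have dec_H: "Y \<in> H j" if "Y \<in> decaying q" for Y j
    using dec_onto[OF that, of j] unfolding H_def F_def decaying_def by blast
  have H_add: "X + Y \<in> H j" if XY: "X \<in> H j" "Y \<in> H j" for j X Y
  proof -
    from XY obtain X' Y' where "X' \<in> F" "X = (S \<mu> ^^ j) X'" "Y' \<in> F" "Y = (S \<mu> ^^ j) Y'"
      unfolding H_def by blast
    moreover from this have "X' + Y' \<in> F" by (auto simp: F_def intro: holomorphic_map_add)
    ultimately show ?thesis unfolding H_def by (metis image_eqI shifted_funpow_add)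
  qed
  have H_scale: "field_scale c X \<in> H j" if X: "X \<in> H j" for j c X
  proof -
    from X obtain X' where "X' \<in> F" "X = (S \<mu> ^^ j) X'" unfolding H_def by blast
    moreover from this have "field_scale c X' \<in> F"
      by (auto simp: F_def intro: holomorphic_map_scale) (simp add: field_scale_def)
    ultimately show ?thesis unfolding H_def by (metis image_eqI shifted_funpow_scale)
  qed
  have H_0: "0 \<in> H j" for j
  proof -
    have "0 \<in> F" by (simp add: F_def holomorphic_map_def)
    then show ?thesis unfolding H_def using shifted_funpow_zero by (metis image_eqI)
  qed
  define W where "W = {w :: 'n list. set w \<subseteq> UNIV \<and> length w \<le> k} \<times> (UNIV :: 'm set)"
  have "\<exists>M. \<forall>j\<ge>M. \<forall>X\<in>H M. \<exists>Y\<in>H j. \<forall>(w, i)\<in>W.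
      word_deriv w (\<lambda>x. X x $ i) 0 = word_deriv w (\<lambda>x. Y x $ i) 0"
  proof -
    let ?l = "\<lambda>(w, i) X. word_deriv w (\<lambda>x. (X x :: complex ^ 'm) $ i) 0"
    have "\<exists>M. \<forall>j\<ge>M. \<forall>X\<in>H M. \<exists>Y\<in>H j. \<forall>w\<in>W. ?l w X = ?l w Y"
    proof (rule chain_stabilises[where V = "{X. holomorphic_map X}" and scl = field_scale])
      show "finite W" unfolding W_def by (intro finite_cartesian_product finite_lists_length_le) auto
      show "?l w (X + Y) = ?l w X + ?l w Y"
        if "X \<in> {X. holomorphic_map X}" "Y \<in> {X. holomorphic_map X}" for w X Y
        using that by (cases w) (simp add: holomorphic_map_def word_deriv_add)
      show "?l w (field_scale c X) = c * ?l w X" if "X \<in> {X. holomorphic_map X}" for w c X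
        using that by (cases w) (simp add: holomorphic_map_def word_deriv_cmult field_scale_def)
      show "field_scale (- 1) X = - X" for X :: "complex ^ 'n \<Rightarrow> complex ^ 'm"
        by (simp add: field_scale_def fun_eq_iff vec_eq_iff)
      show "H j \<subseteq> {X. holomorphic_map X}" for j
        unfolding H_def using SnF by (auto simp: F_def)
    qed (fact dec H_0 H_add H_scale)+
    then show ?thesis by (auto simp: case_prod_unfold)
  qed
  then obtain M where M: "\<And>j X. j \<ge> M \<Longrightarrow> X \<in> H M \<Longrightarrow> \<exists>Y\<in>H j. \<forall>(w, i)\<in>W.
      word_deriv w (\<lambda>x. X x $ i) 0 = word_deriv w (\<lambda>x. Y x $ i) 0" by meson
  have stat: "H M \<subseteq> H j" if j: "j \<ge> M" for j
  proof
    fix X assume X: "X \<in> H M"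
    obtain Y where Y: "Y \<in> H j" 
      and eq: "\<forall>(w, i)\<in>W. word_deriv w (\<lambda>x. X x $ i) 0 = word_deriv w (\<lambda>x. Y x $ i) 0"
      using M[OF j X] by blast
    have hX: "holomorphic_map X" and hY: "holomorphic_map Y"
      using X Y SnF unfolding H_def F_def by auto
    have hD: "holomorphic_map (X + field_scale (- 1) Y)"
      by (intro holomorphic_map_add holomorphic_map_scale hX hY)
    have "X + field_scale (- 1) Y \<in> decaying q"
    proof (rule k[OF hD])
      fix w :: "'n list" and i :: 'm assume "length w < k"
      then have "(w, i) \<in> W" by (simp add: W_def)
      then have "word_deriv w (\<lambda>x. X x $ i) 0 = word_deriv w (\<lambda>x. Y x $ i) 0" using eq by blast
      moreover have "word_deriv w (\<lambda>x. X x $ i + (- 1) * Y x $ i) 0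
          = word_deriv w (\<lambda>x. X x $ i) 0 + word_deriv w (\<lambda>x. (- 1) * Y x $ i) 0"
        using hX hY by (intro word_deriv_add entire_cmult) (auto simp: holomorphic_map_def)
      moreover have "word_deriv w (\<lambda>x. (- 1) * Y x $ i) 0 = (- 1) * word_deriv w (\<lambda>x. Y x $ i) 0"
        using hY by (intro word_deriv_cmult) (auto simp: holomorphic_map_def)
      ultimately show "word_deriv w (\<lambda>x. (X + field_scale (- 1) Y) x $ i) 0 = 0"
        by (simp add: field_scale_def)
    qed
    then have "(X + field_scale (- 1) Y) + Y \<in> H j" using dec_H H_add Y by blast
    moreover have "(X + field_scale (- 1) Y) + Y = X"
      by (simp add: field_scale_def fun_eq_iff vec_eq_iff)
    ultimately show "X \<in> H j" by simp
  qed
  \<comment> \<open>Fitting: \<open>S\<^sup>M\<^sup>+\<^sup>N X0\<close> lies in \<open>S\<^sup>M F = S\<^sup>M\<^sup>+\<^sup>N F\<close>, so it can be cancelled by a field in \<open>F\<close>\<close>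
  define X0 :: "complex ^ 'n \<Rightarrow> complex ^ 'm" where "X0 = (\<lambda>x. v)"
  have "holomorphic_map X0" by (simp add: X0_def holomorphic_map_def)
  have hol_S: "holomorphic_map ((S \<mu> ^^ j) X0)" for j
    by (induction j) (auto intro: holomorphic_shifted \<open>holomorphic_map X0\<close>)
  have at0: "(S \<mu> ^^ j) X0 0 = ((\<lambda>u. B 0 *v u - \<mu> *s u) ^^ j) v" for j
    by (induction j) (simp_all add: X0_def shifted_def transfer_def)
  have "(S \<mu> ^^ N) X0 \<in> F" using hol_S at0 v by (simp add: F_def)
  then have "(S \<mu> ^^ M) ((S \<mu> ^^ N) X0) \<in> H (M + N)"
    using stat[of "M + N"] unfolding H_def by auto
  then obtain Z where Z: "Z \<in> F" "(S \<mu> ^^ M) ((S \<mu> ^^ N) X0) = (S \<mu> ^^ (M + N)) Z"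
    unfolding H_def by blast
  have "(S \<mu> ^^ (M + N)) (X0 - Z) = 0"
    using Z(2) by (simp add: shifted_funpow_diff funpow_add)
  moreover have "holomorphic_map (X0 - Z)" "(X0 - Z) 0 = v"
    using Z(1) \<open>holomorphic_map X0\<close> by (auto simp: F_def X0_def intro: holomorphic_map_diff)
  ultimately show ?thesis by blast
qed

end

section \<open>Pairing generalised eigenfields with generalised eigenforms\<close>

text \<open>The analogue of \<^const>\<open>shifted\<close> for functions: composition with \<open>\<gamma>\<close>, minus \<open>\<mu>\<close>.\<close>
definition koopman :: "('a \<Rightarrow> 'a) \<Rightarrow> complex \<Rightarrow> ('a \<Rightarrow> complex) \<Rightarrow> 'a \<Rightarrow> complex" where
  "koopman \<gamma> \<mu> f = (\<lambda>x. f (\<gamma> x) - \<mu> * f x)"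

text \<open>The complex bilinear pairing of covectors and vectors, not a Hermitian product.\<close>
definition dot :: "complex ^ 'm \<Rightarrow> complex ^ 'm \<Rightarrow> complex" where
  "dot u v = (\<Sum>i\<in>UNIV. u $ i * v $ i)"

lemma dot_diff_left: "dot (u - u') v = dot u v - dot u' v"
  and dot_diff_right: "dot u (v - v') = dot u v - dot u v'"
  and dot_scale_left: "dot (c *s u) v = c * dot u v"
  and dot_scale_right: "dot u (c *s v) = c * dot u v"
  by (simp_all add: dot_def algebra_simps sum_subtractf sum_distrib_left)

lemma dot_transpose: "dot (transpose A *v u) v = dot u (A *v v)"
proof -
  have "dot (transpose A *v u) v = (\<Sum>i\<in>UNIV. \<Sum>k\<in>UNIV. A $ k $ i * u $ k * v $ i)"
    by (simp add: dot_def matrix_vector_mult_def transpose_def sum_distrib_right)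
  also have "\<dots> = (\<Sum>k\<in>UNIV. \<Sum>i\<in>UNIV. A $ k $ i * u $ k * v $ i)" by (rule sum.swap)
  also have "\<dots> = dot u (A *v v)"
    by (simp add: dot_def matrix_vector_mult_def sum_distrib_left mult_ac)
  finally show ?thesis .
qed

lemma dot_axis: "dot u (axis j 1) = u $ j"
proof -
  have "dot u (axis j 1) = (\<Sum>i\<in>UNIV. if i = j then u $ i else 0)"
    unfolding dot_def by (rule sum.cong) (auto simp: axis_def)
  then show ?thesis by simp
qed

lemma koopman_funpow_zero: "(koopman \<gamma> \<mu> ^^ N) (\<lambda>x. 0) = (\<lambda>x. 0)"
  by (induction N) (simp_all add: koopman_def)

lemma koopman_funpow_lincomb:
  "(koopman \<gamma> \<mu> ^^ N) (\<lambda>x. f x + c * g x) = (\<lambda>x. (koopman \<gamma> \<mu> ^^ N) f x + c * (koopman \<gamma> \<mu> ^^ N) g x)"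
  by (induction N) (simp_all add: koopman_def algebra_simps)

lemma shifted_transfer: "shifted \<gamma> B \<mu> (transfer \<gamma> B X) = transfer \<gamma> B (shifted \<gamma> B \<mu> X)"
  by (simp add: shifted_def transfer_def fun_eq_iff matrix_vector_mult_diff_distrib vec.scale)

lemma shifted_funpow_transfer:
  "(shifted \<gamma> B \<mu> ^^ N) (transfer \<gamma> B X) = transfer \<gamma> B ((shifted \<gamma> B \<mu> ^^ N) X)"
  by (induction N) (simp_all add: shifted_transfer)

text \<open>
  Pairing is multiplicative: for dual cocycles \<open>B'\<close> and \<open>B\<close> the function \<open>\<langle>\<theta>, X\<rangle> \<circ> \<gamma>\<close> is the pairing of the
  transferred form with the transferred field, so eigenvalues multiply, and the Leibniz
  rule bounds the nilpotency.
\<close>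
lemma generalised_eigenfunction_dot:
  assumes dual: "\<And>x u v. dot (B' x *v u) (B x *v v) = dot u v"
  shows "(shifted \<gamma> B' \<kappa> ^^ a) \<theta> = 0 \<Longrightarrow> (shifted \<gamma> B \<nu> ^^ b) X = 0 \<Longrightarrow>
    (koopman \<gamma> (\<kappa> * \<nu>) ^^ (a + b)) (\<lambda>x. dot (\<theta> x) (X x)) = (\<lambda>x. 0)"
proof (induction "a + b" arbitrary: a b \<theta> X)
  case 0
  then show ?case by (simp add: dot_def)
next
  case (Suc n)
  show ?case
  proof (cases "a = 0 \<or> b = 0")
    case True
    then have "\<theta> = 0 \<or> X = 0" using Suc.prems by auto
    then have "(\<lambda>x. dot (\<theta> x) (X x)) = (\<lambda>x. 0)" by (auto simp: dot_def)
    then show ?thesis by (simp only: koopman_funpow_zero)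
  next
    case False
    then obtain a' b' where ab: "a = Suc a'" "b = Suc b'" by (metis not0_implies_Suc)
    let ?f = "\<lambda>x. dot (shifted \<gamma> B' \<kappa> \<theta> x) (transfer \<gamma> B X x)"
    let ?g = "\<lambda>x. dot (\<theta> x) (shifted \<gamma> B \<nu> X x)"
    have split: "koopman \<gamma> (\<kappa> * \<nu>) (\<lambda>x. dot (\<theta> x) (X x)) = (\<lambda>x. ?f x + \<kappa> * ?g x)"
      by (simp add: koopman_def shifted_def transfer_def fun_eq_iff dot_diff_left dot_diff_right
          dot_scale_left dot_scale_right dual algebra_simps)
    have "(koopman \<gamma> (\<kappa> * \<nu>) ^^ (a' + b)) ?f = (\<lambda>x. 0)"
    proof (rule Suc.hyps(1))
      show "n = a' + b" using Suc.hyps(2) ab by simp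
      show "(shifted \<gamma> B' \<kappa> ^^ a') (shifted \<gamma> B' \<kappa> \<theta>) = 0"
        using Suc.prems(1) unfolding ab by (simp add: funpow_swap1)
      show "(shifted \<gamma> B \<nu> ^^ b) (transfer \<gamma> B X) = 0"
        unfolding shifted_funpow_transfer Suc.prems(2) by (simp add: transfer_def fun_eq_iff)
    qed
    moreover have "(koopman \<gamma> (\<kappa> * \<nu>) ^^ (a + b')) ?g = (\<lambda>x. 0)"
    proof (rule Suc.hyps(1))
      show "n = a + b'" using Suc.hyps(2) ab by simp
      show "(shifted \<gamma> B \<nu> ^^ b') (shifted \<gamma> B \<nu> X) = 0"
        using Suc.prems(2) unfolding ab by (simp add: funpow_swap1)
    qed (rule Suc.prems(1))
    moreover have "a' + b = n" "a + b' = n" "a + b = Suc n" using Suc.hyps(2) ab by auto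
    ultimately show ?thesis
      by (simp add: funpow_Suc_right split koopman_funpow_lincomb del: funpow.simps)
  qed
qed

section \<open>Eigenfunctions of a contraction\<close>

definition gradient :: "(complex ^ 'n \<Rightarrow> complex) \<Rightarrow> complex ^ 'n \<Rightarrow> complex ^ 'n" where
  "gradient f x = (\<chi> j. dir_deriv f (axis j 1) x)"

lemma dir_deriv_gradient: "entire f \<Longrightarrow> dir_deriv f v x = dot (gradient f x) v"
  by (subst dir_deriv_expand) (simp_all add: dot_def gradient_def mult.commute)

lemma constant_if_gradient_0:
  assumes "entire f" "\<And>x. gradient f x = 0"
  shows "f x = f 0"
proof -
  have "cmod (f x - f 0) \<le> 0 * norm x"
  proof (rule norm_le_of_derivative_bound)
    show "entire (\<lambda>x. f x - f 0)" by (intro entire_diff assms entire_const)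
    fix y v
    have "((\<lambda>x. f x - f 0) has_derivative (\<lambda>v. dir_deriv f v y)) (at y)"
      using has_derivative_diff[OF entire_has_derivative[OF assms(1)] has_derivative_const] by simp
    then have "dir_deriv (\<lambda>x. f x - f 0) v y = dir_deriv f v y" by (rule dir_deriv_eq)
    then show "cmod (dir_deriv (\<lambda>x. f x - f 0) v y) \<le> 0 * norm v"
      by (simp add: dir_deriv_gradient assms dot_def)
  qed simp
  then show ?thesis by simp
qed

context contraction
begin

definition inv_jacobian :: "complex ^ 'n \<Rightarrow> complex ^ 'n ^ 'n" where
  "inv_jacobian x = jacobian (inv \<gamma>) (at (\<gamma> x))"

lemma inv_jacobian_left: "inv_jacobian x ** jacobian \<gamma> (at x) = mat 1"
proof -
  have "(\<lambda>y. inv \<gamma> (\<gamma> y)) = (\<lambda>y. y)" using bij_contraction by (simp add: bij_is_inj)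
  then have "inv_jacobian x ** jacobian \<gamma> (at x) = jacobian (\<lambda>y. y) (at x)"
    using jacobian_compose[OF hol_inv hol, of x] by (simp add: inv_jacobian_def)
  also have "\<dots> = mat 1"
    using frechet_derivative_at[OF has_derivative_ident, of x, symmetric]
    by (simp add: jacobian_def matrix_id_mat_1[unfolded id_def])
  finally show ?thesis .
qed

lemma inv_jacobian_right: "jacobian \<gamma> (at x) ** inv_jacobian x = mat 1"
  using inv_jacobian_left matrix_left_right_inverse by blast

lemma entire_inv_jacobian: "entire (\<lambda>x. inv_jacobian x $ i $ j)"
  unfolding inv_jacobian_def by (rule entire_compose[OF entire_jacobian_nth[OF hol_inv] hol])

lemma entire_transpose_jacobian: "entire (\<lambda>x. transpose (jacobian \<gamma> (at x)) $ i $ j)"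
  unfolding transpose_def by (simp add: entire_jacobian_nth[OF hol])

sublocale fields: contraction_cocycle \<gamma> inv_jacobian
  by unfold_locales (rule entire_inv_jacobian)

sublocale forms: contraction_cocycle \<gamma> "\<lambda>x. transpose (jacobian \<gamma> (at x))"
  by unfold_locales (rule entire_transpose_jacobian)

lemma forms_fields_dual: "dot (transpose (jacobian \<gamma> (at x)) *v u) (inv_jacobian x *v v) = dot u v"
  unfolding dot_transpose by (simp add: matrix_vector_mul_assoc inv_jacobian_right)

lemma entire_koopman: "entire f \<Longrightarrow> entire (koopman \<gamma> \<mu> f)"
  unfolding koopman_def by (intro entire_diff entire_cmult entire_compose[OF _ hol])

lemma eigenfunction_orbit:
  assumes "koopman \<gamma> \<mu> f = (\<lambda>x. 0)"
  shows "f ((\<gamma> ^^ j) x) = \<mu> ^ j * f x"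
proof (induction j)
  case (Suc j)
  have "f (\<gamma> y) = \<mu> * f y" for y
    using fun_cong[OF assms, of y] by (simp add: koopman_def)
  with Suc show ?case by simp
qed simp

lemma entire_along_orbit: "entire f \<Longrightarrow> (\<lambda>j. f ((\<gamma> ^^ j) x)) \<longlonglongrightarrow> f 0"
  using continuous_on_tendsto_compose[OF entire_continuous[of f UNIV] orbit_tendsto] by simp

text \<open>Along an orbit \<open>f\<close> is multiplied by \<open>\<mu>\<close> at each step and yet converges to \<open>f 0\<close>.\<close>
lemma eigenvalue_le_1:
  assumes f: "entire f" "koopman \<gamma> \<mu> f = (\<lambda>x. 0)" and x: "f x \<noteq> 0"
  shows "cmod \<mu> \<le> 1"
proof (rule ccontr)
  assume "\<not> cmod \<mu> \<le> 1"
  then have \<mu>: "cmod \<mu> > 1" by simp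
  have "Bseq (\<lambda>j. f ((\<gamma> ^^ j) x))"
    using entire_along_orbit[OF f(1)] convergent_imp_Bseq convergentI by blast
  then obtain K where K: "\<And>j. cmod (\<mu> ^ j * f x) \<le> K"
    unfolding eigenfunction_orbit[OF f(2)] by (metis BseqE)
  obtain j where "cmod \<mu> ^ j > K / cmod (f x)"
    using real_arch_pow[OF \<mu>] by blast
  then have "cmod (\<mu> ^ j * f x) > K" using x by (simp add: norm_mult norm_power field_simps)
  with K[of j] show False by simp
qed

lemma eigenvalue_nonzero:
  assumes "koopman \<gamma> \<mu> f = (\<lambda>x. 0)" and "f x \<noteq> 0"
  shows "\<mu> \<noteq> 0"
proof
  assume "\<mu> = 0"
  then have "f (\<gamma> y) = 0" for y using eigenfunction_orbit[OF assms(1), of 1 y] by simp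
  moreover obtain y where "x = \<gamma> y" using bij_contraction by (meson bij_pointE)
  ultimately show False using assms(2) by simp
qed

text \<open>
  An invariant function equals its limit \<open>f 0\<close> along orbits. There are no Jordan blocks above it: \<open>f \<circ> \<gamma> - f\<close> vanishes at
  the fixed point, so if it is constant then it is zero.
\<close>
lemma generalised_eigenvalue_1_constant:
  assumes "entire f" "(koopman \<gamma> 1 ^^ N) f = (\<lambda>x. 0)"
  shows "f x = f 0"
  using assms
proof (induction N arbitrary: f x)
  case 0 then show ?case by simp
next
  case (Suc N)
  have "koopman \<gamma> 1 f y = koopman \<gamma> 1 f 0" for y
    by (rule Suc.IH[OF entire_koopman[OF Suc.prems(1)]])
      (use Suc.prems(2) in \<open>simp add: funpow_swap1\<close>)
  then have "koopman \<gamma> 1 f = (\<lambda>x. 0)" by (simp add: fun_eq_iff koopman_def)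
  then have "f ((\<gamma> ^^ j) x) = f x" for j using eigenfunction_orbit[of 1 f j x] by simp
  then have "(\<lambda>j. f x) \<longlonglongrightarrow> f 0" using entire_along_orbit[OF Suc.prems(1), of x] by simp
  then show ?case by (simp add: LIMSEQ_const_iff)
qed

lemma eigenfunction_from_generalised:
  assumes "entire f" "(koopman \<gamma> \<mu> ^^ N) f = (\<lambda>x. 0)" "f \<noteq> (\<lambda>x. 0)"
  obtains g where "entire g" "koopman \<gamma> \<mu> g = (\<lambda>x. 0)" "g \<noteq> (\<lambda>x. 0)"
  using assms
proof (induction N arbitrary: f thesis)
  case 0 then show ?case by simp
next
  case (Suc N)
  show ?case
  proof (cases "koopman \<gamma> \<mu> f = (\<lambda>x. 0)")
    case True then show ?thesis using Suc.prems by blast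
  next
    case False
    show ?thesis
      by (rule Suc.IH[OF Suc.prems(1) entire_koopman[OF Suc.prems(2)] _ False])
        (use Suc.prems(3) in \<open>simp_all add: funpow_swap1\<close>)
  qed
qed

text \<open>Pull-back commutes with the exterior derivative.\<close>
lemma gradient_eigenform:
  assumes f: "entire f" "koopman \<gamma> \<mu> f = (\<lambda>x. 0)"
  shows "forms.S \<mu> (gradient f) = 0"
proof
  fix x
  have f\<gamma>: "(\<lambda>y. f (\<gamma> y)) = (\<lambda>y. \<mu> * f y)"
    using eigenfunction_orbit[OF f(2), of 1] by (simp add: fun_eq_iff)
  have "(transpose (jacobian \<gamma> (at x)) *v gradient f (\<gamma> x)) $ j = \<mu> * gradient f x $ j" for j
  proof -
    have "(transpose (jacobian \<gamma> (at x)) *v gradient f (\<gamma> x)) $ j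
        = dot (gradient f (\<gamma> x)) (jacobian \<gamma> (at x) *v axis j 1)"
      unfolding dot_axis[symmetric] by (rule dot_transpose)
    also have "\<dots> = dir_deriv (\<lambda>y. f (\<gamma> y)) (axis j 1) x"
      by (simp add: dir_deriv_compose[OF f(1) hol] dir_deriv_gradient[OF f(1)])
    also have "\<dots> = \<mu> * gradient f x $ j"
      unfolding f\<gamma> by (simp add: dir_deriv_cmult[OF f(1)] gradient_def)
    finally show ?thesis .
  qed
  then show "forms.S \<mu> (gradient f) x = 0 x"
    by (simp add: shifted_def transfer_def vec_eq_iff)
qed

lemma entire_dot: "holomorphic_map \<theta> \<Longrightarrow> holomorphic_map X \<Longrightarrow> entire (\<lambda>x. dot (\<theta> x) (X x))"
  unfolding dot_def holomorphic_map_def by (intro entire_sum entire_mult) auto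

lemma holomorphic_gradient: "entire f \<Longrightarrow> holomorphic_map (gradient f)"
  unfolding holomorphic_map_def gradient_def by (simp add: entire_dir_deriv)

text \<open>
  An identity theorem for eigenforms that needs no power series: every point is carried into the given neighbourhood, and
  vanishing propagates backwards along the orbit.
\<close>
lemma eigenform_zero_near_0:
  assumes \<theta>: "forms.S \<mu> \<theta> = 0" and \<mu>: "\<mu> \<noteq> 0"
    and e: "e > 0" "\<And>x. norm x < e \<Longrightarrow> \<theta> x = 0"
  shows "\<theta> x = 0"
proof -
  have step: "\<mu> *s \<theta> y = transpose (jacobian \<gamma> (at y)) *v \<theta> (\<gamma> y)" for y
    using fun_cong[OF \<theta>, of y] by (simp add: shifted_def transfer_def)
  have "\<theta> ((\<gamma> ^^ j) x) = 0 \<Longrightarrow> \<theta> x = 0" for j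
  proof (induction j)
    case (Suc j)
    have "\<mu> *s \<theta> ((\<gamma> ^^ j) x) = 0" unfolding step using Suc.prems by simp
    then show ?case using Suc.IH \<mu> by simp
  qed simp
  moreover obtain N where "norm ((\<gamma> ^^ N) x) < e"
    using iterates_to_0[OF e(1), of "norm x"] by (metis order_refl)
  ultimately show ?thesis using e(2) by blast
qed

text \<open>
  The eigenvalues of composition with \<open>\<gamma>\<close> are monomials in the numbers \<open>\<beta>\<^sub>i\<close>. The proof is a descent:
  differentiating an eigenfunction along the eigenfield \<open>X\<^sub>i\<close> divides its eigenvalue by \<open>\<beta>\<^sub>i\<close>, and
  eigenvalues have modulus at most one; so after finitely many steps all derivatives along the frame
  vanish, and the function is a constant, with eigenvalue one.
\<close>
lemma eigenvalue_is_monomial: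
  fixes X :: "'n \<Rightarrow> complex ^ 'n \<Rightarrow> complex ^ 'n"
  assumes \<beta>: "\<And>i. \<beta> i \<noteq> 0" "\<And>i. cmod (\<beta> i) < 1"
    and X: "\<And>i. holomorphic_map (X i)" "\<And>i. (fields.S (1 / \<beta> i) ^^ M i) (X i) = 0"
    and frame: "e > 0" "\<And>x u. norm x < e \<Longrightarrow> (\<And>i. dot u (X i x) = 0) \<Longrightarrow> u = 0"
    and f: "entire f" "(koopman \<gamma> \<mu> ^^ N) f = (\<lambda>x. 0)" "f \<noteq> (\<lambda>x. 0)"
  shows "\<exists>p. \<mu> = (\<Prod>i\<in>UNIV. \<beta> i ^ p i)"
proof -
  define r where "r = Max (range (\<lambda>i. cmod (\<beta> i)))"
  have r: "\<And>i. cmod (\<beta> i) \<le> r" "r < 1" "r > 0"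
  proof -
    show le: "cmod (\<beta> i) \<le> r" for i unfolding r_def by (intro Max_ge) auto
    show "r < 1" unfolding r_def using \<beta>(2) by (subst Max_less_iff) auto
    show "r > 0" using le[of undefined] \<beta>(1)[of undefined] by (meson less_le_trans zero_less_norm_iff)
  qed
  have "\<mu> \<noteq> 0"
    using eigenfunction_from_generalised[OF f] eigenvalue_nonzero by (metis ext)
  then obtain K where K: "r ^ K < cmod \<mu>" using real_arch_pow_inv[of "cmod \<mu>" r] r by auto
  then show ?thesis using f
  proof (induction K arbitrary: \<mu> f N)
    case 0
    obtain g where g: "entire g" "koopman \<gamma> \<mu> g = (\<lambda>x. 0)" "g \<noteq> (\<lambda>x. 0)"
      using eigenfunction_from_generalised[OF 0(2-4)] .
    then obtain x where "g x \<noteq> 0" by blast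
    then show ?case using eigenvalue_le_1[OF g(1,2)] 0 by fastforce
  next
    case (Suc K)
    obtain g where g: "entire g" "koopman \<gamma> \<mu> g = (\<lambda>x. 0)" "g \<noteq> (\<lambda>x. 0)"
      using eigenfunction_from_generalised[OF Suc.prems(2-4)] .
    then obtain x0 where x0: "g x0 \<noteq> 0" by blast
    have \<mu>0: "\<mu> \<noteq> 0" by (rule eigenvalue_nonzero[OF g(2) x0])
    show ?case
    proof (cases "\<exists>i. (\<lambda>x. dot (gradient g x) (X i x)) \<noteq> (\<lambda>x. 0)")
      case True
      then obtain i where i: "(\<lambda>x. dot (gradient g x) (X i x)) \<noteq> (\<lambda>x. 0)" by blast
      have "(forms.S \<mu> ^^ 1) (gradient g) = 0" using gradient_eigenform[OF g(1,2)] by simp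
      then have gen: "(koopman \<gamma> (\<mu> * (1 / \<beta> i)) ^^ (1 + M i)) (\<lambda>x. dot (gradient g x) (X i x)) = (\<lambda>x. 0)"
        by (rule generalised_eigenfunction_dot[OF forms_fields_dual _ X(2)])
      have "r ^ K * cmod (\<beta> i) \<le> r ^ K * r" using r by (intro mult_left_mono) auto
      then have "r ^ K * cmod (\<beta> i) < cmod \<mu>" using Suc.prems(1) by (simp add: mult.commute)
      then have "r ^ K < cmod (\<mu> * (1 / \<beta> i))"
        using \<beta>(1)[of i] by (simp add: norm_divide field_simps)
      then obtain p where p: "\<mu> * (1 / \<beta> i) = (\<Prod>l\<in>UNIV. \<beta> l ^ p l)"
        using Suc.IH[OF _ entire_dot[OF holomorphic_gradient[OF g(1)] X(1)] gen i] by blast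
      have "\<mu> = \<beta> i * (\<Prod>l\<in>UNIV. \<beta> l ^ p l)" using \<beta>(1)[of i] by (simp flip: p)
      also have "\<dots> = (\<Prod>l\<in>UNIV. \<beta> l ^ (p(i := Suc (p i))) l)"
        by (simp add: prod.remove[of UNIV i])
      finally show ?thesis by blast
    next
      case False
      then have zero: "dot (gradient g x) (X i x) = 0" for i x by (metis (mono_tags))
      have "gradient g x = 0" for x
        by (rule eigenform_zero_near_0[OF gradient_eigenform[OF g(1,2)] \<mu>0 frame(1)])
          (rule frame(2)[OF _ zero])
      then have const: "g x = g 0" for x by (rule constant_if_gradient_0[OF g(1)])
      have "\<mu> * g x0 = g x0"
        using eigenfunction_orbit[OF g(2), of 1 x0] const[of "\<gamma> x0"] const[of x0] by simp
      then have "\<mu> = 1" using x0 by simp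
      then show ?thesis by (intro exI[of _ "\<lambda>_. 0"]) simp
    qed
  qed
qed

text \<open>
  Cauchy estimates on the unit ball show that the derivatives of the iterates of \<open>\<gamma>\<close> at \<open>0\<close>, which
  multiply \<open>v\<close> by powers of \<open>c\<close>, tend to zero.
\<close>
lemma eigenvalue_jacobian_less_1:
  assumes v: "jacobian \<gamma> (at 0) *v v = c *s v" "v \<noteq> 0"
  shows "cmod c < 1"
proof -
  obtain i where i: "v $ i \<noteq> 0" using v(2) by (auto simp: vec_eq_iff)
  define e where "e = cmod (v $ i) / (2 * norm v)"
  have e: "e > 0" using i v(2) by (simp add: e_def)
  obtain N where N: "\<And>j x. j \<ge> N \<Longrightarrow> norm x \<le> 1 \<Longrightarrow> norm ((\<gamma> ^^ j) x) < e"
    using iterates_to_0[OF e, of 1] by blast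
  have pow: "jacobian (\<gamma> ^^ j) (at 0) *v v = c ^ j *s v" for j
  proof (induction j)
    case 0
    show ?case
      using frechet_derivative_at[OF has_derivative_ident, of "0 :: complex ^ 'n", symmetric]
      by (simp add: jacobian_def matrix_id_mat_1 id_def[symmetric])
  next
    case (Suc j)
    have "jacobian (\<gamma> ^^ Suc j) (at 0) = jacobian \<gamma> (at 0) ** jacobian (\<gamma> ^^ j) (at 0)"
      using jacobian_compose[OF hol hol_iterate, of j 0] by (simp add: comp_def)
    then show ?case
      using Suc by (simp del: funpow.simps add: v(1) vec.scale vector_smult_assoc mult.commute flip: matrix_vector_mul_assoc)
  qed
  have ent: "entire (\<lambda>x. (\<gamma> ^^ Suc N) x $ i)" using hol_iterate holomorphic_map_def by blast
  have "cmod (dir_deriv (\<lambda>x. (\<gamma> ^^ Suc N) x $ i) v 0) \<le> e * norm v / 1"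
  proof (rule Cauchy_estimate_dir_deriv[OF ent])
    fix y :: "complex ^ 'n" assume "y \<in> cball 0 1"
    then show "cmod ((\<gamma> ^^ Suc N) y $ i) \<le> e"
      using N[of "Suc N" y] Finite_Cartesian_Product.norm_nth_le[of "(\<gamma> ^^ Suc N) y" i]
      by (simp del: funpow.simps)
  qed simp
  moreover have "dir_deriv (\<lambda>x. (\<gamma> ^^ Suc N) x $ i) v 0 = c ^ Suc N * v $ i"
  proof -
    have "((\<lambda>x. (\<gamma> ^^ Suc N) x $ i) has_derivative (\<lambda>v. (jacobian (\<gamma> ^^ Suc N) (at 0) *v v) $ i)) (at 0)"
      by (rule bounded_linear.has_derivative[OF bounded_linear_vec_nth
            holomorphic_map_has_jacobian[OF hol_iterate]])
    from dir_deriv_eq[OF this, of v] show ?thesis unfolding pow by simp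
  qed
  ultimately have "cmod c ^ Suc N * cmod (v $ i) \<le> cmod (v $ i) / 2"
    using v(2) by (simp add: norm_mult norm_power e_def)
  then have "cmod c ^ Suc N \<le> 1 / 2" using i by (simp add: field_simps)
  moreover have "cmod c ^ Suc N \<ge> 1" if "cmod c \<ge> 1" by (rule one_le_power[OF that])
  ultimately show ?thesis by fastforce
qed

end

section \<open>Incidence algebras and lower triangular matrices\<close>

text \<open>
  For a reflexive and transitive \<open>R\<close> this is the incidence algebra of \<open>R\<close>. Both the structure group and the
  block triangular normal form of the linear part are described by such relations.
\<close>
definition incidence :: "('n \<Rightarrow> 'n \<Rightarrow> bool) \<Rightarrow> (complex ^ 'n ^ 'n) set" where
  "incidence R = {A. \<forall>i j. A $ i $ j \<noteq> 0 \<longrightarrow> R i j}"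

lemma incidence_mult:
  assumes "transp R" "A \<in> incidence R" "B \<in> incidence R"
  shows "A ** B \<in> incidence R"
  unfolding incidence_def
proof safe
  fix i j assume "(A ** B) $ i $ j \<noteq> 0"
  then obtain k where "A $ i $ k * B $ k $ j \<noteq> 0"
    unfolding matrix_matrix_mult_def by (auto elim: sum.not_neutral_contains_not_neutral)
  then have "R i k" "R k j" using assms by (auto simp: incidence_def)
  then show "R i j" using assms(1) by (meson transpD)
qed

text \<open>
  Left multiplication by an invertible member is injective on the (finite-dimensional) incidence
  algebra, hence onto; so the inverse lies in the algebra.
\<close>
lemma incidence_inverse:
  assumes R: "reflp R" "transp R" and A: "A \<in> incidence R" and AB: "B ** A = mat 1"
  shows "B \<in> incidence R"
proof -
  have sub: "subspace (incidence R)"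
    unfolding subspace_def incidence_def by (auto, metis add_0)
  have lin: "linear ((**) A)"
    by (simp add: linear_iff matrix_matrix_mult_def vec_eq_iff distrib_left sum.distrib scaleR_sum_right)
  have inj: "inj ((**) A)"
    by (rule inj_on_inverseI[of _ "(**) B"]) (simp add: matrix_mul_assoc AB)
  have "(**) A ` incidence R = incidence R"
  proof (rule subspace_dim_equal)
    show "subspace ((**) A ` incidence R)" by (rule linear_subspace_image[OF lin sub])
    show "(**) A ` incidence R \<subseteq> incidence R" using incidence_mult[OF R(2) A] by blast
    show "dim (incidence R) \<le> dim ((**) A ` incidence R)"
      using dim_image_eq[OF lin inj_on_subset[OF inj], of "incidence R"] by simp
  qed (rule sub)
  moreover have "mat 1 \<in> incidence R"
    using R(1) by (auto simp: incidence_def mat_def dest: reflpD)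
  ultimately obtain C where C: "C \<in> incidence R" "A ** C = mat 1" by (metis imageE)
  have "B = B ** (A ** C)" by (simp add: C(2))
  also have "\<dots> = C" by (simp add: matrix_mul_assoc AB)
  finally show ?thesis using C(1) by simp
qed

text \<open>At the least point that is moved, injectivity is violated.\<close>
lemma decreasing_permutation_is_id:
  fixes p :: "'n::{finite,linorder} \<Rightarrow> 'n"
  assumes "inj p" "\<And>i. p i \<le> i"
  shows "p = id"
proof (rule ccontr)
  assume "p \<noteq> id"
  then have ne: "{i. p i \<noteq> i} \<noteq> {}" by (auto simp: fun_eq_iff)
  define i where "i = Min {i. p i \<noteq> i}"
  have i: "p i \<noteq> i" using Min_in[OF _ ne] by (simp add: i_def)
  then have "p i < i" using assms(2)[of i] by simp
  then have "\<not> i \<le> p i" by simp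
  moreover have "i \<le> p i" if "p (p i) \<noteq> p i"
    unfolding i_def by (rule Min_le) (use that in \<open>simp_all add: i_def\<close>)
  ultimately have "p (p i) = p i" by blast
  with i show False using injD[OF assms(1), of "p i" i] by simp
qed

lemma det_lower_triangular:
  fixes A :: "'a::comm_ring_1 ^ 'n::{finite,linorder} ^ 'n::{finite,linorder}"
  assumes ld: "\<And>i j. i < j \<Longrightarrow> A $ i $ j = 0"
  shows "det A = (\<Prod>i\<in>UNIV. A $ i $ i)"
proof -
  let ?pp = "\<lambda>p. of_int (sign p) * (\<Prod>i\<in>UNIV. A $ i $ p i)"
  have "(\<Sum>p\<in>{p. p permutes (UNIV :: 'n set)}. ?pp p) = (\<Sum>p\<in>{id}. ?pp p)"
  proof (rule sum.mono_neutral_right)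
    show "\<forall>p\<in>{p. p permutes UNIV} - {id}. ?pp p = 0"
    proof
      fix p :: "'n \<Rightarrow> 'n" assume p: "p \<in> {p. p permutes UNIV} - {id}"
      then obtain i where "\<not> p i \<le> i"
        using decreasing_permutation_is_id[of p] permutes_inj by blast
      then have "A $ i $ p i = 0" using ld by simp
      then have "(\<Prod>i\<in>UNIV. A $ i $ p i) = 0" by (intro prod_zero) auto
      then show "?pp p = 0" by simp
    qed
  qed (auto simp: permutes_id)
  then show ?thesis by (simp add: det_def)
qed

section \<open>Triangular form adapted to the generalised eigenspaces\<close>

text \<open>The vector \<open>p(L) u\<close>.\<close>
definition peval :: "complex ^ 'n ^ 'n \<Rightarrow> complex poly \<Rightarrow> complex ^ 'n \<Rightarrow> complex ^ 'n" where
  "peval L p u = (\<Sum>i\<le>degree p. coeff p i *s (((*v) L) ^^ i) u)"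

lemma peval_eq:
  assumes "degree p \<le> n"
  shows "peval L p u = (\<Sum>i\<le>n. coeff p i *s (((*v) L) ^^ i) u)"
  unfolding peval_def by (rule sum.mono_neutral_left) (use assms in \<open>auto simp: coeff_eq_0\<close>)

lemma peval_linear_factor:
  "peval L ([:- z, 1:] * q) u = L *v peval L q u - z *s peval L q u"
proof -
  let ?n = "degree q" and ?v = "\<lambda>i. (((*v) L) ^^ i) u"
  have "degree ([:- z, 1:] * q) \<le> Suc ?n" by (rule order_trans[OF degree_mult_le]) simp
  then have "peval L ([:- z, 1:] * q) u = (\<Sum>i\<le>Suc ?n. coeff ([:- z, 1:] * q) i *s ?v i)"
    by (rule peval_eq)
  also have "\<dots> = (\<Sum>i\<le>Suc ?n. coeff (pCons 0 q) i *s ?v i) - (\<Sum>i\<le>Suc ?n. (z * coeff q i) *s ?v i)"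
    unfolding sum_subtractf[symmetric]
    by (rule sum.cong) (simp_all flip: vector_sub_rdistrib)
  also have "(\<Sum>i\<le>Suc ?n. coeff (pCons 0 q) i *s ?v i) = (\<Sum>i\<le>?n. coeff q i *s ?v (Suc i))"
    by (subst sum.atMost_Suc_shift) simp
  also have "\<dots> = L *v peval L q u" by (simp add: peval_def vec.sum vec.scale)
  also have "(\<Sum>i\<le>Suc ?n. (z * coeff q i) *s ?v i) = z *s peval L q u"
    by (subst peval_eq[of q "Suc ?n"]) (simp_all add: vec.scale_sum_right vector_smult_assoc del: sum.atMost_Suc)
  finally show ?thesis .
qed

text \<open>The vectors \<open>u, L u, L\<^sup>2 u, \<dots>\<close> are linearly dependent.\<close>
lemma exists_annihilating_poly:
  fixes L :: "complex ^ 'n ^ 'n"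
  obtains p where "p \<noteq> 0" "peval L p u = 0"
proof -
  let ?f = "\<lambda>i. (((*v) L) ^^ i) u" and ?I = "{..CARD('n)}"
  have peval_sum: "peval L (\<Sum>i\<in>?I. monom (a i) i) u = (\<Sum>i\<in>?I. a i *s ?f i)" for a
  proof -
    let ?p = "\<Sum>i\<in>?I. monom (a i) i"
    have coeff: "coeff ?p i = (if i \<le> CARD('n) then a i else 0)" for i
      by (simp add: coeff_sum sum.delta')
    then have "degree ?p \<le> CARD('n)" by (intro degree_le) simp
    then have "peval L ?p u = (\<Sum>i\<in>?I. coeff ?p i *s ?f i)" by (rule peval_eq)
    also have "\<dots> = (\<Sum>i\<in>?I. a i *s ?f i)" by (rule sum.cong) (simp_all add: coeff)
    finally show ?thesis .
  qed
  have "\<exists>a. (\<exists>i\<in>?I. a i \<noteq> 0) \<and> (\<Sum>i\<in>?I. a i *s ?f i) = 0"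
  proof (cases "inj_on ?f ?I")
    case True
    have "vec.dependent (?f ` ?I)"
    proof (rule vec.dependent_biggerset_general)
      have "vec.dim (?f ` ?I) \<le> CARD('n)"
        using vec.dim_subset_UNIV[of "?f ` ?I"] by (simp add: vec.dimension_def card_cart_basis)
      then show "vec.dim (?f ` ?I) < card (?f ` ?I)" by (simp add: card_image[OF True])
    qed
    then obtain b where b: "\<exists>v\<in>?f ` ?I. b v \<noteq> 0" "(\<Sum>v\<in>?f ` ?I. b v *s v) = 0"
      by (auto simp: vec.dependent_finite)
    then show ?thesis
      by (intro exI[of _ "b \<circ> ?f"]) (auto simp: sum.reindex[OF True] comp_def)
  next
    case False
    then obtain i j where ij: "i \<in> ?I" "j \<in> ?I" "i \<noteq> j" "?f i = ?f j" by (auto simp: inj_on_def)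
    define a :: "nat \<Rightarrow> complex" where "a k = (if k = i then 1 else 0) - (if k = j then 1 else 0)" for k
    have "(\<Sum>k\<in>?I. a k *s ?f k)
        = (\<Sum>k\<in>?I. (if k = i then ?f k else 0) - (if k = j then ?f k else 0))"
      by (rule sum.cong) (auto simp: a_def)
    also have "\<dots> = 0" using ij by (simp add: sum_subtractf)
    finally show ?thesis using ij by (intro exI[of _ a]) (auto simp: a_def intro!: bexI[of _ i])
  qed
  then obtain a i where a: "i \<in> ?I" "a i \<noteq> 0" "(\<Sum>i\<in>?I. a i *s ?f i) = 0" by blast
  have "coeff (\<Sum>i\<in>?I. monom (a i) i) i = a i" using a(1) by (simp add: coeff_sum sum.delta')
  then have "(\<Sum>i\<in>?I. monom (a i) i) \<noteq> 0" using a(2) by auto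
  then show ?thesis using that peval_sum a(3) by metis
qed

text \<open>An eigenvector modulo an invariant subspace, found by splitting off linear factors.\<close>
lemma eigenvector_mod_subspace:
  fixes L :: "complex ^ 'n ^ 'n"
  assumes W: "vec.subspace W" and u: "u \<notin> W"
  obtains w e where "w \<notin> W" "L *v w - e *s w \<in> W"
proof -
  have "\<exists>w e. w \<notin> W \<and> L *v w - e *s w \<in> W" if "p \<noteq> 0" "peval L p u \<in> W" for p
    using that
  proof (induction "degree p" arbitrary: p)
    case 0
    then obtain a where p: "p = [:a:]" "a \<noteq> 0" by (metis degree_eq_zeroE pCons_0_0)
    then have "a *s u \<in> W" using 0 by (simp add: peval_def)
    then have "inverse a *s (a *s u) \<in> W" by (rule vec.subspace_scale[OF W])
    then show ?case using p u by (simp add: vector_smult_assoc)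
  next
    case (Suc d)
    then obtain z where "poly p z = 0"
      using fundamental_theorem_of_algebra[of p] constant_degree[of p] by auto
    then obtain q where q: "p = [:- z, 1:] * q" by (auto simp: poly_eq_0_iff_dvd)
    have q0: "q \<noteq> 0" using q Suc.prems by auto
    show ?case
    proof (cases "peval L q u \<in> W")
      case True
      have "degree p = Suc (degree q)" using q q0 by (simp add: degree_mult_eq del: mult_pCons_left)
      then show ?thesis using Suc.hyps(1)[of q] Suc.hyps(2) q0 True by simp
    next
      case False
      have "L *v peval L q u - z *s peval L q u \<in> W"
        using Suc.prems(2) unfolding q peval_linear_factor .
      with False show ?thesis by blast
    qed
  qed
  moreover obtain p where "p \<noteq> 0" "peval L p u = 0" using exists_annihilating_poly .
  ultimately show ?thesis using that vec.subspace_0[OF W] by metis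
qed

lemma mat_vector_mult: "mat c *v (x :: complex ^ 'n) = c *s x"
  by (simp add: vec_eq_iff matrix_vector_mult_def mat_def if_distrib[of "\<lambda>c. c * _"] sum.delta cong: if_cong)

text \<open>
  A basis adapted to the generalised eigenspaces, built one vector at a time. An eigenvector for \<open>e\<close> modulo
  the span of the earlier vectors can be corrected so that its error lies in the span of the earlier
  vectors with the same eigenvalue, because \<open>L - e\<close> maps the span of the others onto itself.
\<close>
lemma adapted_basis:
  fixes L :: "complex ^ 'n ^ 'n"
  assumes "n \<le> CARD('n)"
  shows "\<exists>(v :: nat \<Rightarrow> complex ^ 'n) c. inj_on v {..<n} \<and> vec.independent (v ` {..<n}) \<and>
    (\<forall>k<n. L *v v k - c k *s v k \<in> vec.span (v ` {l. l < k \<and> c l = c k}))"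
  using assms
proof (induction n)
  case 0
  show ?case by (simp add: vec.independent_empty)
next
  case (Suc n)
  then obtain v :: "nat \<Rightarrow> complex ^ 'n" and c where v: "inj_on v {..<n}" "vec.independent (v ` {..<n})"
    and Lv: "\<And>k. k < n \<Longrightarrow> L *v v k - c k *s v k \<in> vec.span (v ` {l. l < k \<and> c l = c k})"
    by auto
  let ?W = "vec.span (v ` {..<n})"
  have "vec.dim ?W = n"
    using vec.dim_eq_card_independent[OF v(2)] by (simp add: card_image[OF v(1)])
  moreover have "vec.dim (UNIV :: (complex ^ 'n) set) = CARD('n)"
    using vec.dim_UNIV by (simp add: card_cart_basis)
  ultimately have "?W \<noteq> UNIV" using Suc.prems by (metis Suc_n_not_le_n)
  then obtain u where "u \<notin> ?W" by blast
  then obtain w e where w: "w \<notin> ?W" "L *v w - e *s w \<in> ?W"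
    using eigenvector_mod_subspace[OF vec.subspace_span] by blast
  define D where "D = L - mat e"
  have D: "D *v x = L *v x - e *s x" for x
    by (simp add: D_def matrix_vector_mult_diff_rdistrib mat_vector_mult)
  let ?V1 = "vec.span (v ` {l. l < n \<and> c l = e})" and ?V2 = "vec.span (v ` {l. l < n \<and> c l \<noteq> e})"
  have sub: "vec.subspace ((*v) D ` ?V2)" by (intro vec.subspace_image vec.subspace_span)
  have onto: "v k \<in> (*v) D ` ?V2" if "k < n" "c k \<noteq> e" for k
    using that
  proof (induction k rule: less_induct)
    case (less k)
    have "v ` {l. l < k \<and> c l = c k} \<subseteq> (*v) D ` ?V2" using less by auto
    then have "vec.span (v ` {l. l < k \<and> c l = c k}) \<subseteq> (*v) D ` ?V2"
      using sub by (rule vec.span_minimal)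
    then have y: "L *v v k - c k *s v k \<in> (*v) D ` ?V2" using Lv[OF less.prems(1)] by blast
    have "v k \<in> ?V2" using less.prems by (intro vec.span_base) blast
    then have "D *v v k - (L *v v k - c k *s v k) \<in> (*v) D ` ?V2"
      using vec.subspace_diff[OF sub _ y] by blast
    then have "inverse (c k - e) *s ((c k - e) *s v k) \<in> (*v) D ` ?V2"
      by (intro vec.subspace_scale[OF sub, of "(c k - e) *s v k"]) (simp add: D vector_sub_rdistrib)
    moreover have "inverse (c k - e) *s ((c k - e) *s v k) = v k"
      unfolding vector_smult_assoc using less.prems(2) by simp
    ultimately show ?case by simp
  qed
  have V2: "?V2 \<subseteq> (*v) D ` ?V2"
    using onto by (intro vec.span_minimal sub) auto
  have "{..<n} = {l. l < n \<and> c l = e} \<union> {l. l < n \<and> c l \<noteq> e}" by auto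
  then have "?W = {x + y |x y. x \<in> ?V1 \<and> y \<in> ?V2}" by (simp only: image_Un vec.span_Un)
  then obtain x y where xy: "x \<in> ?V1" "y \<in> ?V2" "D *v w = x + y" using w(2) D by auto
  then obtain z where z: "z \<in> ?V2" "y = D *v z" using V2 by blast
  have zW: "z \<in> ?W" using z(1) vec.span_mono[of "v ` {l. l < n \<and> c l \<noteq> e}" "v ` {..<n}"] by auto
  define w' where "w' = w - z"
  have w'W: "w' \<notin> ?W"
  proof
    assume "w' \<in> ?W"
    then have "w' + z \<in> ?W" by (intro vec.span_add zW)
    then show False using w(1) by (simp add: w'_def)
  qed
  have w'D: "L *v w' - e *s w' \<in> ?V1"
  proof -
    have "D *v w' = x" using xy z by (simp add: w'_def vec.diff)
    then show ?thesis using xy(1) by (simp flip: D)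
  qed
  let ?v = "v(n := w')" and ?c = "c(n := e)"
  have im: "?v ` {..<Suc n} = insert w' (v ` {..<n})" by (auto simp: lessThan_Suc)
  have same: "?v ` {l. l < k \<and> ?c l = d} = v ` {l. l < k \<and> c l = d}" if "k \<le> n" for k d
    using that by (intro image_cong) auto
  have "w' \<notin> v ` {..<n}" using w'W vec.span_base[of w' "v ` {..<n}"] by blast
  then have "inj_on ?v {..<Suc n}"
    using v(1) by (auto simp: inj_on_def lessThan_Suc)
  moreover have "vec.independent (?v ` {..<Suc n})"
    unfolding im by (rule vec.independent_insertI[OF w'W v(2)])
  moreover have "L *v ?v k - ?c k *s ?v k \<in> vec.span (?v ` {l. l < k \<and> ?c l = ?c k})" if "k < Suc n" for k
    using that same[of k] Lv[of k] w'D by (cases "k = n") auto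
  ultimately show ?case by blast
qed

lemma span_image_coefficients:
  assumes "finite J" "x \<in> vec.span (v ` J)"
  shows "\<exists>a. x = (\<Sum>j\<in>J. a j *s v j)"
  using assms(2)
proof (induction rule: vec.span_induct_alt)
  case base show ?case by (intro exI[of _ "\<lambda>_. 0"]) simp
next
  case (step c y z)
  then obtain a j where a: "z = (\<Sum>j\<in>J. a j *s v j)" and j: "j \<in> J" "y = v j" by blast
  have "c *s y + z = (\<Sum>i\<in>J. (if i = j then c *s v i else 0)) + (\<Sum>j\<in>J. a j *s v j)"
    using j assms(1) by (simp add: a sum.delta)
  also have "\<dots> = (\<Sum>i\<in>J. ((if i = j then c else 0) + a i) *s v i)"
    unfolding sum.distrib[symmetric] by (rule sum.cong) (simp_all add: vector_sadd_rdistrib)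
  finally show ?case by (rule exI[of _ "\<lambda>i. (if i = j then c else 0) + a i"])
qed

lemma position_less_iff: "position i < position j \<longleftrightarrow> i < j"
proof -
  have "position i < position j" if "i < j" for i j :: 'a
  proof -
    have "{k. k \<le> i} \<subseteq> {k. k \<le> j}" "j \<in> {k. k \<le> j}" "j \<notin> {k. k \<le> i}" using that by auto
    then show ?thesis unfolding position_def by (intro psubset_card_mono) auto
  qed
  then show ?thesis by (metis less_asym less_irrefl linorder_cases)
qed

lemma position_bounds:
  fixes i :: "'n::{finite,linorder}"
  shows "1 \<le> position i" "position i \<le> CARD('n)"
proof -
  have "card {i} \<le> position i" unfolding position_def by (rule card_mono) auto
  then show "1 \<le> position i" by simp
  show "position i \<le> CARD('n)" unfolding position_def by (rule card_mono) auto
qed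

text \<open>
  This reorders an adapted basis. The index type carries an abstract linear order, so its positions are matched
  with the ranks of the keys.
\<close>
lemma enumerate_by_key:
  fixes K :: "nat \<Rightarrow> nat"
  assumes "inj_on K {..<CARD('n::{finite,linorder})}"
  obtains \<sigma> :: "'n::{finite,linorder} \<Rightarrow> nat"
  where "bij_betw \<sigma> UNIV {..<CARD('n::{finite,linorder})}" "\<And>i j. i < j \<Longrightarrow> K (\<sigma> i) < K (\<sigma> j)"
proof -
  let ?N = "CARD('n)" and ?M = "K ` {..<CARD('n)}"
  have cM: "card ?M = ?N" using card_image[OF assms] by simp
  obtain h where h: "bij_betw h {..<card ?M} ?M" "strict_mono_on {..<card ?M} h"
    by (rule ex_bij_betw_strict_mono_card[of ?M]) auto
  define \<sigma> where "\<sigma> i = inv_into {..<?N} K (h (position i - 1))" for i :: 'n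
  have pos: "position i - 1 \<in> {..<card ?M}" for i :: 'n
    using position_bounds[of i] by (simp add: cM)
  have hM: "h (position i - 1) \<in> ?M" for i :: 'n
    using bij_betw_apply[OF h(1) pos] .
  have K\<sigma>: "K (\<sigma> i) = h (position i - 1)" for i
    unfolding \<sigma>_def by (rule f_inv_into_f[OF hM])
  have less: "K (\<sigma> i) < K (\<sigma> j)" if "i < j" for i j
    unfolding K\<sigma> using that position_bounds[of i] position_bounds[of j] position_less_iff[of i j]
    by (intro strict_mono_onD[OF h(2) pos pos]) auto
  have "inj \<sigma>" by (rule injI) (metis less less_irrefl linorder_cases)
  moreover have "\<sigma> i \<in> {..<?N}" for i unfolding \<sigma>_def by (rule inv_into_into[OF hM])
  ultimately have "bij_betw \<sigma> UNIV {..<?N}"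
    using card_subset_eq[of "{..<?N}" "range \<sigma>"] by (auto intro!: bij_betw_imageI simp: card_image)
  with less show ?thesis using that by blast
qed

text \<open>
  Sorting the adapted basis by eigenvalue, and backwards within each class, moves the errors below the
  diagonal.
\<close>
lemma triangular_form:
  fixes L :: "complex ^ 'n::{finite,linorder} ^ 'n::{finite,linorder}" and key :: "complex \<Rightarrow> nat"
  shows "\<exists>(Q :: complex ^ 'n::{finite,linorder} ^ 'n::{finite,linorder}) Q' T \<beta>.
    Q ** Q' = mat 1 \<and> Q' ** Q = mat 1 \<and> L ** Q = Q ** T \<and> (\<forall>i. T $ i $ i = \<beta> i) \<and>
    T \<in> incidence (\<lambda>i j. j \<le> i \<and> \<beta> i = \<beta> j) \<and> (\<forall>i j. i \<le> j \<longrightarrow> key (\<beta> i) \<le> key (\<beta> j))"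
proof -
  let ?N = "CARD('n)"
  obtain v :: "nat \<Rightarrow> complex ^ 'n::{finite,linorder}" and c where v: "inj_on v {..<?N}" "vec.independent (v ` {..<?N})"
    and Lv: "\<And>k. k < ?N \<Longrightarrow> L *v v k - c k *s v k \<in> vec.span (v ` {l. l < k \<and> c l = c k})"
    using adapted_basis[of ?N L] by auto
  \<comment> \<open>lexicographic: the eigenvalue first, then the reversed order of construction\<close>
  define K where "K k = key (c k) * ?N + (?N - 1 - k)" for k
  have K_le: "key (c k) \<le> key (c l)" if "K k \<le> K l" "l < ?N" for k l
  proof (rule ccontr)
    assume "\<not> key (c k) \<le> key (c l)"
    then have "Suc (key (c l)) * ?N \<le> key (c k) * ?N" by (intro mult_right_mono) auto
    then show False using that by (simp add: K_def)
  qed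
  have K_less: "l < k" if "K k < K l" "key (c k) = key (c l)" for k l
    using that by (simp add: K_def)
  have "inj_on K {..<?N}"
  proof (rule inj_onI)
    fix k l assume kl: "k \<in> {..<?N}" "l \<in> {..<?N}" "K k = K l"
    then have "key (c k) = key (c l)" using K_le[of k l] K_le[of l k] by simp
    then show "k = l" using kl by (simp add: K_def)
  qed
  then obtain \<sigma> :: "'n::{finite,linorder} \<Rightarrow> nat" where \<sigma>: "bij_betw \<sigma> UNIV {..<?N}" "\<And>i j. i < j \<Longrightarrow> K (\<sigma> i) < K (\<sigma> j)"
    using enumerate_by_key by blast
  have \<sigma>N: "\<sigma> i < ?N" for i using bij_betw_apply[OF \<sigma>(1), of i] by simp
  define \<beta> where "\<beta> i = c (\<sigma> i)" for i
  define b where "b i = v (\<sigma> i)" for i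
  define Q where "Q = (\<chi> r i. b i $ r)"
  have Q: "Q *v u = (\<Sum>i\<in>UNIV. u $ i *s b i)" for u
    by (simp add: Q_def matrix_vector_mult_def vec_eq_iff mult.commute)
  have col: "column i Q = b i" for i by (simp add: column_def Q_def vec_eq_iff)
  have "columns Q = v ` {..<?N}"
  proof -
    have "columns Q = v ` range \<sigma>" by (auto simp: columns_def col b_def)
    then show ?thesis using \<sigma>(1) by (simp add: bij_betw_def)
  qed
  moreover have "vec.span (v ` {..<?N}) = UNIV"
  proof -
    have "vec.dim (v ` {..<?N}) = ?N"
      using vec.dim_eq_card_independent[OF v(2)] card_image[OF v(1)] by simp
    then show ?thesis using vec.dim_eq_full[of "v ` {..<?N}"] by (simp add: vec.dimension_def card_cart_basis)
  qed
  ultimately obtain Q' where Q': "Q ** Q' = mat 1" using matrix_right_invertible_span_columns by metis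
  have "\<exists>a. L *v b i - \<beta> i *s b i = (\<Sum>l\<in>{l. i < l \<and> \<beta> l = \<beta> i}. a l *s b l)" for i
  proof -
    have "v ` {l. l < \<sigma> i \<and> c l = c (\<sigma> i)} \<subseteq> b ` {l. i < l \<and> \<beta> l = \<beta> i}"
    proof
      fix x assume "x \<in> v ` {l. l < \<sigma> i \<and> c l = c (\<sigma> i)}"
      then obtain k where k: "x = v k" "k < \<sigma> i" "c k = c (\<sigma> i)" by blast
      then have "k \<in> {..<?N}" using \<sigma>N[of i] by simp
      then obtain l where l: "k = \<sigma> l" using \<sigma>(1) unfolding bij_betw_def by blast
      have "i < l"
      proof (rule ccontr)
        assume "\<not> i < l"
        then have "l = i \<or> K (\<sigma> l) < K (\<sigma> i)" using \<sigma>(2) by force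
        then show False using K_less[of "\<sigma> l" "\<sigma> i"] k l by auto
      qed
      then show "x \<in> b ` {l. i < l \<and> \<beta> l = \<beta> i}" using k l by (auto simp: b_def \<beta>_def)
    qed
    then have "vec.span (v ` {l. l < \<sigma> i \<and> c l = c (\<sigma> i)}) \<subseteq> vec.span (b ` {l. i < l \<and> \<beta> l = \<beta> i})"
      by (rule vec.span_mono)
    moreover have "L *v b i - \<beta> i *s b i \<in> vec.span (v ` {l. l < \<sigma> i \<and> c l = c (\<sigma> i)})"
      using Lv[OF \<sigma>N[of i]] by (simp add: b_def \<beta>_def)
    ultimately have "L *v b i - \<beta> i *s b i \<in> vec.span (b ` {l. i < l \<and> \<beta> l = \<beta> i})"
      by (rule subsetD)
    then show ?thesis by (intro span_image_coefficients) auto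
  qed
  then obtain a where a: "\<And>i. L *v b i - \<beta> i *s b i = (\<Sum>l\<in>{l. i < l \<and> \<beta> l = \<beta> i}. a i l *s b l)" by metis
  define T where "T = (\<chi> l i. (if l = i then \<beta> i else 0) + (if i < l \<and> \<beta> l = \<beta> i then a i l else 0))"
  have "L ** Q = Q ** T"
  proof -
    have "L *v b i = (\<Sum>l\<in>UNIV. T $ l $ i *s b l)" for i
    proof -
      have "(\<Sum>l\<in>UNIV. T $ l $ i *s b l) = (\<Sum>l\<in>UNIV. (if l = i then \<beta> l *s b l else 0))
          + (\<Sum>l\<in>UNIV. (if i < l \<and> \<beta> l = \<beta> i then a i l *s b l else 0))"
        unfolding sum.distrib[symmetric] by (rule sum.cong) (auto simp: T_def)
      also have "(\<Sum>l\<in>UNIV. (if i < l \<and> \<beta> l = \<beta> i then a i l *s b l else 0)) = L *v b i - \<beta> i *s b i"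
        unfolding a by (rule sum.inter_filter[symmetric, of UNIV, simplified]) simp
      finally show ?thesis by simp
    qed
    then have "(L *v b i) $ r = (\<Sum>l\<in>UNIV. b l $ r * T $ l $ i)" for i r
      by (simp add: mult.commute)
    then show ?thesis
      by (simp add: vec_eq_iff matrix_matrix_mult_def matrix_vector_mult_def Q_def)
  qed
  moreover have "T $ i $ i = \<beta> i" for i by (simp add: T_def)
  moreover have "T \<in> incidence (\<lambda>i j. j \<le> i \<and> \<beta> i = \<beta> j)"
    by (auto simp: incidence_def T_def split: if_splits)
  moreover have "key (\<beta> i) \<le> key (\<beta> j)" if "i \<le> j" for i j
    using that \<sigma>(2)[of i j] K_le[OF _ \<sigma>N, of "\<sigma> i" j] by (cases "i = j") (auto simp: \<beta>_def less_imp_le)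
  moreover have "Q' ** Q = mat 1" using Q' matrix_left_right_inverse by blast
  ultimately show ?thesis using Q' by (intro exI[of _ Q] exI[of _ Q'] exI[of _ T] exI[of _ \<beta>]) auto
qed


section \<open>Characteristic polynomials and the numbering of eigenvalues\<close>

lemma map_matrix_const_poly_mult:
  fixes A B :: "complex ^ 'n ^ 'n"
  shows "map_matrix (\<lambda>a. [:a:]) (A ** B) = map_matrix (\<lambda>a. [:a:]) A ** map_matrix (\<lambda>a. [:a:]) B"
proof -
  have "[:sum f I:] = (\<Sum>i\<in>I. [:f i:])" for f :: "'n \<Rightarrow> complex" and I
  proof (induction I rule: infinite_finite_induct)
    case (insert x I)
    have "[:f x + sum f I:] = [:f x:] + [:sum f I:]" by simp
    with insert show ?case by (simp del: add_pCons)
  qed auto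
  then show ?thesis by (simp add: vec_eq_iff matrix_matrix_mult_def mult.commute)
qed

lemma charpoly_similar:
  fixes L T Q Q' :: "complex ^ 'n ^ 'n"
  assumes "Q ** Q' = mat 1" "L ** Q = Q ** T"
  shows "charpoly L = charpoly T"
proof -
  let ?C = "map_matrix (\<lambda>a :: complex. [:a:])" and ?X = "mat [:0, 1:] :: complex poly ^ 'n ^ 'n"
  have C1: "?C (mat 1) = (mat 1 :: complex poly ^ 'n ^ 'n)"
    by (simp add: vec_eq_iff mat_def)
  have central: "?X ** A = A ** ?X" for A :: "complex poly ^ 'n ^ 'n"
    by (simp add: vec_eq_iff matrix_matrix_mult_def mat_def if_distrib[of "\<lambda>c. c * _"]
        if_distrib[of "\<lambda>c. _ * c"] sum.delta sum.delta' mult.commute cong: if_cong)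
  have diff: "(A - B) ** D = A ** D - B ** D" "D ** (A - B) = D ** A - D ** B"
    for A B D :: "complex poly ^ 'n ^ 'n"
    by (simp_all add: vec_eq_iff matrix_matrix_mult_def left_diff_distrib right_diff_distrib sum_subtractf)
  have "(?X - ?C L) ** ?C Q = ?C Q ** (?X - ?C T)"
    by (simp add: diff central assms(2) flip: map_matrix_const_poly_mult)
  then have "det (?X - ?C L) * det (?C Q) = det (?C Q) * det (?X - ?C T)"
    by (simp only: flip: det_mul)
  then have "det (?X - ?C L) * det (?C Q) * det (?C Q') = det (?C Q) * det (?X - ?C T) * det (?C Q')"
    by (simp only:)
  then have "det (?X - ?C L) * (det (?C Q) * det (?C Q')) = det (?X - ?C T) * (det (?C Q) * det (?C Q'))"
    by (simp only: mult_ac)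
  moreover have "det (?C Q) * det (?C Q') = 1"
    by (simp add: assms(1) C1 det_I flip: det_mul map_matrix_const_poly_mult)
  ultimately show ?thesis by (simp add: charpoly_def)
qed

lemma alg_multiplicity_triangular:
  fixes T :: "complex ^ 'n::{finite,linorder} ^ 'n::{finite,linorder}"
  assumes "\<And>i j. i < j \<Longrightarrow> T $ i $ j = 0"
  shows "alg_multiplicity T c = card {i. T $ i $ i = c}"
proof -
  have "charpoly T = (\<Prod>i\<in>UNIV. [:- (T $ i $ i), 1:])"
    unfolding charpoly_def by (subst det_lower_triangular) (simp_all add: assms mat_def)
  moreover have "order c (\<Prod>i\<in>I. [:- (T $ i $ i), 1:]) = card {i \<in> I. T $ i $ i = c}" if "finite I" for I
    using that
  proof (induction I)
    case (insert x I)
    have "{i \<in> insert x I. T $ i $ i = c} = (if T $ x $ x = c then insert x {i \<in> I. T $ i $ i = c} else {i \<in> I. T $ i $ i = c})"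
      by auto
    moreover have "order c [:- (T $ x $ x), 1:] = (if T $ x $ x = c then 1 else 0)"
      using order_power_n_n[of c 1] by (auto intro: order_0I)
    moreover have "[:- (T $ x $ x), 1:] * (\<Prod>i\<in>I. [:- (T $ i $ i), 1:]) \<noteq> 0"
      using insert(1) by (simp add: prod_zero_iff del: mult_pCons_left)
    ultimately show ?case using insert by (simp add: order_mult del: mult_pCons_left)
  qed simp
  ultimately show ?thesis unfolding alg_multiplicity_def by (metis (lifting) Collect_cong UNIV_I finite)
qed

lemma eigenvalue_triangular:
  fixes T :: "complex ^ 'n::{finite,linorder} ^ 'n::{finite,linorder}"
  assumes "\<And>i j. i < j \<Longrightarrow> T $ i $ j = 0"
  shows "T $ i $ i \<in> eigenvalues T"
proof -
  let ?D = "T - mat (T $ i $ i)"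
  have "det ?D = (\<Prod>j\<in>UNIV. ?D $ j $ j)"
    by (rule det_lower_triangular) (simp add: assms mat_def)
  also have "\<dots> = 0" by (rule prod_zero) (auto intro!: bexI[of _ i] simp: mat_def)
  finally have "\<not> invertible ?D" by (simp add: invertible_det_nz)
  then obtain x where "x \<noteq> 0" "?D *v x = 0"
    using matrix_left_invertible_ker[of ?D] invertible_left_inverse[of ?D] by blast
  then show ?thesis
    by (auto simp: eigenvalues_def matrix_vector_mult_diff_rdistrib mat_vector_mult)
qed

lemma eigenvalues_similar:
  fixes L T Q :: "complex ^ 'n ^ 'n"
  assumes "Q' ** Q = mat 1" "L ** Q = Q ** T" "c \<in> eigenvalues T"
  shows "c \<in> eigenvalues L"
proof -
  obtain x where x: "x \<noteq> 0" "T *v x = c *s x" using assms(3) by (auto simp: eigenvalues_def)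
  have "L *v (Q *v x) = c *s (Q *v x)"
    by (simp add: matrix_vector_mul_assoc assms(2)) (simp add: x(2) vec.scale flip: matrix_vector_mul_assoc)
  moreover have "Q *v x \<noteq> 0"
  proof
    assume "Q *v x = 0"
    then have "(Q' ** Q) *v x = 0" by (simp flip: matrix_vector_mul_assoc)
    then show False using x(1) assms(1) by simp
  qed
  ultimately show ?thesis by (auto simp: eigenvalues_def)
qed

text \<open>
  By sortedness the classes below that of \<open>i\<close> fill an initial segment ending before \<open>i\<close>, and together with the class
  of \<open>i\<close> they fill one that reaches \<open>i\<close>; the partial sums of multiplicities count these segments.
\<close>
lemma eig_index_sorted:
  fixes d :: "'n::{finite,linorder} \<Rightarrow> nat"
  assumes range: "\<And>i. d i \<in> {1..m}" and mono: "\<And>i j. i \<le> j \<Longrightarrow> d i \<le> d j"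
    and \<mu>: "\<And>l. l \<in> {1..m} \<Longrightarrow> \<mu> l = card {i. d i = l}"
  shows "eig_index m \<mu> i = d i"
proof -
  have sum: "(\<Sum>l\<in>A. \<mu> l) = card {i. d i \<in> A}" if "A \<subseteq> {1..m}" for A
  proof -
    have "finite A" using that finite_subset by blast
    have "{i. d i \<in> A} = (\<Union>l\<in>A. {i. d i = l})" by auto
    also have "card \<dots> = (\<Sum>l\<in>A. card {i. d i = l})"
      by (rule card_UN_disjoint) (auto simp: \<open>finite A\<close>)
    also have "\<dots> = (\<Sum>l\<in>A. \<mu> l)" using \<mu> that by (intro sum.cong) auto
    finally show ?thesis by simp
  qed
  show ?thesis
    unfolding eig_index_def
  proof (rule the_equality)
    have "{j. d j \<in> {1..<d i}} \<subset> {j. j \<le> i}"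
    proof
      show "{j. d j \<in> {1..<d i}} \<subseteq> {j. j \<le> i}"
      proof
        fix j assume "j \<in> {j. d j \<in> {1..<d i}}"
        then have "\<not> i \<le> j" using mono[of i j] by auto
        then show "j \<in> {j. j \<le> i}" by simp
      qed
      show "{j. d j \<in> {1..<d i}} \<noteq> {j. j \<le> i}" by auto
    qed
    then have below: "card {j. d j \<in> {1..<d i}} < position i"
      unfolding position_def by (intro psubset_card_mono) auto
    have upto: "position i \<le> card {j. d j \<in> {1..d i}}"
      unfolding position_def using range mono by (intro card_mono) auto
    have "{1..<d i} \<subseteq> {1..m}" "{1..d i} \<subseteq> {1..m}" using range[of i] by auto
    with below upto range[of i]
    show "d i \<in> {1..m} \<and> (\<Sum>l\<in>{1..<d i}. \<mu> l) < position i \<and> position i \<le> (\<Sum>l\<in>{1..d i}. \<mu> l)"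
      by (simp only: sum)
    fix k assume k: "k \<in> {1..m} \<and> (\<Sum>l\<in>{1..<k}. \<mu> l) < position i \<and> position i \<le> (\<Sum>l\<in>{1..k}. \<mu> l)"
    then have k1: "card {j. d j \<in> {1..<k}} < position i" and k2: "position i \<le> card {j. d j \<in> {1..k}}"
    proof -
      have "{1..<k} \<subseteq> {1..m}" "{1..k} \<subseteq> {1..m}" using k by auto
      with k show "card {j. d j \<in> {1..<k}} < position i" "position i \<le> card {j. d j \<in> {1..k}}"
        by (simp_all only: sum)
    qed
    show "k = d i"
    proof (rule antisym)
      show "k \<le> d i"
      proof (rule ccontr)
        assume "\<not> k \<le> d i"
        then have "{j. j \<le> i} \<subseteq> {j. d j \<in> {1..<k}}" using range mono by fastforce
        then have "position i \<le> card {j. d j \<in> {1..<k}}" unfolding position_def by (intro card_mono) auto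
        with k1 show False by simp
      qed
      show "d i \<le> k"
      proof (rule ccontr)
        assume "\<not> d i \<le> k"
        then have "{j. d j \<in> {1..k}} \<subseteq> {j. d j \<in> {1..<d i}}" by auto
        then have "card {j. d j \<in> {1..k}} \<le> card {j. d j \<in> {1..<d i}}" by (intro card_mono) auto
        with k2 below show False by simp
      qed
    qed
  qed
qed

text \<open>
  Off the diagonal a block triangular matrix strictly raises a rank and preserves the class, so each
  basis vector is a generalised eigenvector. The rank is a parameter because the lemma is used for a matrix
  and for its transpose.
\<close>
lemma generalised_eigenvector_axis:
  fixes T :: "complex ^ 'n ^ 'n" and rank :: "'n \<Rightarrow> nat"
  assumes diag: "\<And>l. T $ l $ l = \<beta> l"
    and off: "\<And>l j. T $ l $ j \<noteq> 0 \<Longrightarrow> l \<noteq> j \<Longrightarrow> rank j < rank l \<and> \<beta> l = \<beta> j"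
  shows "\<exists>N. ((\<lambda>u. T *v u - \<beta> i *s u) ^^ N) (axis i 1) = 0"
proof -
  let ?D = "\<lambda>u. T *v u - \<beta> i *s u"
  have step: "\<beta> l = \<beta> i \<and> k \<le> rank l" if "(?D ^^ k) (axis i 1) $ l \<noteq> 0" for k l
    using that
  proof (induction k arbitrary: l)
    case 0
    then show ?case by (simp add: axis_def split: if_splits)
  next
    case (Suc k)
    let ?u = "(?D ^^ k) (axis i 1)"
    have "(T *v ?u) $ l = T $ l $ l * ?u $ l + (\<Sum>j\<in>UNIV - {l}. T $ l $ j * ?u $ j)"
      unfolding matrix_vector_mult_def by (simp add: sum.remove[of UNIV l])
    moreover have "T $ l $ l * ?u $ l = \<beta> i * ?u $ l"
      using Suc.IH[of l] by (cases "?u $ l = 0") (auto simp: diag)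
    ultimately have "(\<Sum>j\<in>UNIV - {l}. T $ l $ j * ?u $ j) \<noteq> 0" using Suc.prems by simp
    then obtain j where "j \<in> UNIV - {l}" "T $ l $ j * ?u $ j \<noteq> 0"
      by (rule sum.not_neutral_contains_not_neutral)
    then have j: "j \<noteq> l" "T $ l $ j \<noteq> 0" "?u $ j \<noteq> 0" by auto
    have "rank j < rank l \<and> \<beta> l = \<beta> j" using off j by blast
    then show ?case using Suc.IH[OF j(3)] by auto
  qed
  define N where "N = Suc (Max (range rank))"
  have "rank l < N" for l unfolding N_def by (simp add: less_Suc_eq_le)
  then have "(?D ^^ N) (axis i 1) $ l = 0" for l using step[of N l] by (meson leD)
  then show ?thesis by (intro exI[of _ N]) (simp add: vec_eq_iff)
qed

text \<open>Transports generalised eigenvectors of a normal form back to the original matrix.\<close>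
lemma intertwined_funpow:
  fixes B P T :: "complex ^ 'n ^ 'n"
  assumes "B ** P = P ** T"
  shows "((\<lambda>u. B *v u - \<kappa> *s u) ^^ N) (P *v x) = P *v ((\<lambda>u. T *v u - \<kappa> *s u) ^^ N) x"
proof (induction N)
  case (Suc N)
  have "B *v (P *v y) = P *v (T *v y)" for y by (simp add: matrix_vector_mul_assoc assms)
  then show ?case by (simp add: Suc vec.diff vec.scale)
qed simp

section \<open>From adapted frames to invariant structures\<close>

lemma frame_map_compose:
  assumes "holomorphic_map f" "holomorphic_map g"
  shows "frame_map (f \<circ> g) = frame_map f \<circ> frame_map g"
  using jacobian_compose[OF assms]
  by (auto simp: frame_map_def fun_eq_iff comp_def matrix_mul_assoc)

lemma frame_map_id: "frame_map (\<lambda>x. x) = id"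
  using frechet_derivative_at[OF has_derivative_ident, symmetric]
  by (auto simp: frame_map_def fun_eq_iff jacobian_def matrix_id_mat_1[unfolded id_def])

lemma invariant_under_funpow:
  fixes f :: "complex ^ 'n \<Rightarrow> complex ^ 'n"
  assumes "holomorphic_map f" "invariant_under f P"
  shows "invariant_under (f ^^ N) P"
proof (induction N)
  case 0
  show ?case by (simp add: invariant_under_def id_def frame_map_id)
next
  case (Suc N)
  have "frame_map (f ^^ Suc N) ` P = frame_map f ` (frame_map (f ^^ N) ` P)"
    unfolding funpow.simps frame_map_compose[OF assms(1) holomorphic_map_funpow[OF assms(1)]] image_comp ..
  then show ?case using Suc assms(2) by (simp only: invariant_under_def)
qed

text \<open>
  The change of frame \<open>h\<close> is absorbed by right multiplication with \<open>G\<close>; its inverse in \<open>G\<close> shows that the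
  structure is mapped onto itself and not only into itself.
\<close>
lemma invariant_structure_of_frame:
  fixes s :: "complex ^ 'n \<Rightarrow> complex ^ 'n ^ 'n"
  assumes \<gamma>: "biholomorphism \<gamma>"
    and G: "\<And>g h. g \<in> G \<Longrightarrow> h \<in> G \<Longrightarrow> g ** h \<in> G" "\<And>g. g \<in> G \<Longrightarrow> \<exists>h\<in>G. g ** h = mat 1"
      "\<And>g. g \<in> G \<Longrightarrow> invertible g"
    and s: "\<And>i j. entire (\<lambda>x. s x $ i $ j)" "\<And>x. invertible (s x)"
    and adapted: "\<And>x. \<exists>h\<in>G. jacobian \<gamma> (at x) ** s x = s (\<gamma> x) ** h"
  shows "\<exists>P. holomorphic_G_structure G P \<and> (\<forall>\<delta>\<in>generated_group \<gamma>. invariant_under \<delta> P)"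
proof (intro exI conjI)
  define P where "P = {(x, s x ** g) |x g. g \<in> G}"
  have hol: "holomorphic_map \<gamma>" "holomorphic_map (inv \<gamma>)" and bij: "bij \<gamma>"
    using \<gamma> unfolding biholomorphism_def by auto
  \<comment> \<open>the frame is global, so one trivialization serves all points\<close>
  show "holomorphic_G_structure G P"
    unfolding holomorphic_G_structure_def
  proof (intro conjI allI impI)
    show "P \<subseteq> frame_bundle"
      using s(2) G(3) by (auto simp: P_def frame_bundle_def intro: invertible_mult)
    show "(x, F ** g) \<in> P" if "(x, F) \<in> P \<and> g \<in> G" for x F g
      using that G(1) by (fastforce simp: P_def simp flip: matrix_mul_assoc)
    show "\<exists>U s. open U \<and> x \<in> U \<and> (\<forall>i j. holomorphic_fun_on (\<lambda>y. s y $ i $ j) U) \<and>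
        (\<forall>y\<in>U. invertible (s y) \<and> {F. (y, F) \<in> P} = (\<lambda>g. s y ** g) ` G)" for x
      by (rule exI[of _ UNIV], rule exI[of _ s]) (use s in \<open>auto simp: P_def\<close>)
  qed
  have inv: "frame_map \<gamma> ` P = P"
  proof
    show "frame_map \<gamma> ` P \<subseteq> P"
    proof
      fix z assume "z \<in> frame_map \<gamma> ` P"
      then obtain x g where z: "z = (\<gamma> x, jacobian \<gamma> (at x) ** (s x ** g))" and g: "g \<in> G"
        by (auto simp: P_def frame_map_def)
      obtain h where h: "h \<in> G" "jacobian \<gamma> (at x) ** s x = s (\<gamma> x) ** h" using adapted by blast
      have "z = (\<gamma> x, s (\<gamma> x) ** (h ** g))" by (simp add: z matrix_mul_assoc h(2))
      then show "z \<in> P" unfolding P_def using G(1)[OF h(1) g] by blast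
    qed
    show "P \<subseteq> frame_map \<gamma> ` P"
    proof
      fix z assume "z \<in> P"
      then obtain y g where z: "z = (y, s y ** g)" and g: "g \<in> G" by (auto simp: P_def)
      obtain x where y: "y = \<gamma> x" using bij by (meson bij_pointE)
      obtain h where h: "h \<in> G" "jacobian \<gamma> (at x) ** s x = s (\<gamma> x) ** h" using adapted by blast
      obtain h' where h': "h' \<in> G" "h ** h' = mat 1" using G(2)[OF h(1)] by blast
      have "jacobian \<gamma> (at x) ** (s x ** (h' ** g)) = s y ** ((h ** h') ** g)"
        by (simp add: matrix_mul_assoc h(2) y)
      then have "z = frame_map \<gamma> (x, s x ** (h' ** g))" by (simp add: frame_map_def z y h'(2))
      moreover have "(x, s x ** (h' ** g)) \<in> P" unfolding P_def using G(1)[OF h'(1) g] by blast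
      ultimately show "z \<in> frame_map \<gamma> ` P" by blast
    qed
  qed
  have "frame_map (inv \<gamma>) \<circ> frame_map \<gamma> = id"
  proof -
    have "inv \<gamma> \<circ> \<gamma> = (\<lambda>x. x)" using bij by (simp add: bij_is_inj id_def)
    then show ?thesis using frame_map_compose[OF hol(2,1)] frame_map_id by metis
  qed
  then have "frame_map (inv \<gamma>) ` P = P"
    using inv by (metis image_comp image_id id_apply)
  then show "\<forall>\<delta>\<in>generated_group \<gamma>. invariant_under \<delta> P"
    using inv hol by (auto simp: generated_group_def invariant_under_def[of \<gamma>]
        invariant_under_def[of "inv \<gamma>"] intro!: invariant_under_funpow)
qed

section \<open>Existence of the invariant structure\<close>

lemma dot_axis_matrix: "dot (axis l 1) (A *v axis i 1) = A $ l $ i"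
proof -
  have "dot (axis l 1) (A *v axis i 1) = dot (A *v axis i 1) (axis l 1)"
    by (simp add: dot_def mult.commute)
  also have "\<dots> = A $ l $ i"
    unfolding dot_axis
    by (simp add: matrix_vector_mult_def axis_def if_distrib[of "\<lambda>c. _ * c"] sum.delta cong: if_cong)
  finally show ?thesis .
qed

lemma dependent_on_refl: "dependent_on m \<alpha> j j"
  unfolding dependent_on_def by (intro exI[of _ "\<lambda>_. 0"]) simp

lemma dependent_on_trans:
  assumes "dependent_on m \<alpha> i j" "dependent_on m \<alpha> j k"
  shows "dependent_on m \<alpha> i k"
proof -
  obtain p q where "\<alpha> i = \<alpha> j * (\<Prod>l=1..m. \<alpha> l ^ p l)" "\<alpha> j = \<alpha> k * (\<Prod>l=1..m. \<alpha> l ^ q l)"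
    using assms unfolding dependent_on_def by blast
  then have "\<alpha> i = \<alpha> k * (\<Prod>l=1..m. \<alpha> l ^ (q l + p l))"
    by (simp add: power_add prod.distrib mult.assoc)
  then show ?thesis unfolding dependent_on_def by (rule exI[of _ "\<lambda>l. q l + p l"])
qed

text \<open>
  A monomial in the eigenvalues counted with multiplicity is a monomial in the distinct ones: exponents are added
  over each class.
\<close>
lemma dependent_onI:
  fixes p :: "'n::finite \<Rightarrow> nat"
  assumes "\<alpha> j = \<alpha> k * (\<Prod>i\<in>UNIV. \<alpha> (d i) ^ p i)" "\<And>i. d i \<in> {1..m}"
  shows "dependent_on m \<alpha> j k"
proof -
  have "(\<Prod>i\<in>UNIV. \<alpha> (d i) ^ p i) = (\<Prod>l\<in>{1..m}. \<Prod>i\<in>{i\<in>UNIV. d i = l}. \<alpha> (d i) ^ p i)"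
    by (rule prod.group[symmetric]) (use assms(2) in auto)
  also have "\<dots> = (\<Prod>l\<in>{1..m}. \<alpha> l ^ (\<Sum>i\<in>{i\<in>UNIV. d i = l}. p i))"
    by (rule prod.cong) (auto simp: power_sum)
  finally have "\<alpha> j = \<alpha> k * (\<Prod>l\<in>{1..m}. \<alpha> l ^ (\<Sum>i\<in>{i\<in>UNIV. d i = l}. p i))"
    using assms(1) by simp
  then show ?thesis unfolding dependent_on_def by (rule exI[of _ "\<lambda>l. \<Sum>i\<in>{i\<in>UNIV. d i = l}. p i"])
qed

theorem theorem3:
  fixes \<gamma> :: "complex ^ 'n::{finite,linorder} \<Rightarrow> complex ^ 'n::{finite,linorder}"
    and m :: nat and \<alpha> :: "nat \<Rightarrow> complex"
  assumes "CARD('n) \<ge> 2"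
    and "contraction_at_0 \<gamma>"
    and "eigenvalue_numbering (jacobian \<gamma> (at 0)) m \<alpha>"
  shows "\<exists>P. holomorphic_G_structure
               (G1_alpha m \<alpha> (\<lambda>l. alg_multiplicity (jacobian \<gamma> (at 0)) (\<alpha> l))) P \<and>
             (\<forall>\<delta> \<in> generated_group \<gamma>. invariant_under \<delta> P)"
proof -
  interpret contraction \<gamma> by unfold_locales (rule assms(2))
  let ?L = "jacobian \<gamma> (at 0)"
  let ?G = "G1_alpha m \<alpha> (\<lambda>l. alg_multiplicity ?L (\<alpha> l)) :: (complex ^ 'n::{finite,linorder} ^ 'n::{finite,linorder}) set"
  have \<alpha>: "bij_betw \<alpha> {1..m} (eigenvalues ?L)"
    "\<And>j k. j \<in> {1..m} \<Longrightarrow> k \<in> {1..m} \<Longrightarrow> j \<le> k \<Longrightarrow> cmod (\<alpha> k) \<le> cmod (\<alpha> j)"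
    using assms(3) unfolding eigenvalue_numbering_def by auto
  let ?idx = "inv_into {1..m} \<alpha>"

  from triangular_form[of ?L ?idx] obtain Q Q' T \<beta> where form:
    "(Q :: complex ^ 'n::{finite,linorder} ^ 'n::{finite,linorder}) ** Q' = mat 1 \<and>
    Q' ** Q = mat 1 \<and> ?L ** Q = Q ** T \<and> (\<forall>i. T $ i $ i = \<beta> i) \<and>
    T \<in> incidence (\<lambda>i j. j \<le> i \<and> \<beta> i = \<beta> j) \<and> (\<forall>i j. i \<le> j \<longrightarrow> ?idx (\<beta> i) \<le> ?idx (\<beta> j))"
    by blast
  then have Q: "Q ** Q' = mat 1" "Q' ** Q = mat 1" "?L ** Q = Q ** T"
    and T_diag: "\<And>i. T $ i $ i = \<beta> i"
    and T_inc: "T \<in> incidence (\<lambda>i j. j \<le> i \<and> \<beta> i = \<beta> j)"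
    and \<beta>_mono: "\<And>i j. i \<le> j \<Longrightarrow> ?idx (\<beta> i) \<le> ?idx (\<beta> j)"
    by auto
  have T_low: "T $ i $ j = 0" if "i < j" for i j
    using T_inc that by (force simp: incidence_def)
  have \<beta>_eig: "\<beta> i \<in> eigenvalues ?L" for i
    using eigenvalues_similar[OF Q(2,3)] eigenvalue_triangular[OF T_low, of i] by (simp add: T_diag)
  \<comment> \<open>\<open>d i\<close> will turn out to be the index \<open>k\<^sub>i\<close> of the class of \<open>i\<close>\<close>
  define d where "d i = ?idx (\<beta> i)" for i
  have d: "d i \<in> {1..m}" "\<alpha> (d i) = \<beta> i" for i
    using \<beta>_eig[of i] \<alpha>(1) unfolding d_def bij_betw_def
    by (metis inv_into_into, metis f_inv_into_f)
  have d_mono: "d i \<le> d j" if "i \<le> j" for i j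
    unfolding d_def by (rule \<beta>_mono[OF that])
  have \<beta>_abs: "cmod (\<beta> j) \<le> cmod (\<beta> i)" if "i \<le> j" for i j
    using \<alpha>(2)[OF d(1) d(1) d_mono[OF that]] by (simp add: d(2))
  have "alg_multiplicity ?L (\<alpha> l) = card {i. d i = l}" if "l \<in> {1..m}" for l
  proof -
    have "alg_multiplicity ?L (\<alpha> l) = alg_multiplicity T (\<alpha> l)"
      by (simp add: alg_multiplicity_def charpoly_similar[OF Q(1,3)])
    also have "\<dots> = card {i. \<beta> i = \<alpha> l}"
      by (simp add: alg_multiplicity_triangular[OF T_low] T_diag)
    also have "{i. \<beta> i = \<alpha> l} = {i. d i = l}"
      using \<alpha>(1) d that unfolding bij_betw_def by (auto dest: inj_onD simp flip: d(2))
    finally show ?thesis .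
  qed
  then have eig: "eig_index m (\<lambda>l. alg_multiplicity ?L (\<alpha> l)) i = d i" for i :: "'n::{finite,linorder}"
    by (intro eig_index_sorted d d_mono)

  \<comment> \<open>the structure group consists of the invertible elements of the incidence algebra of \<open>R\<close>\<close>
  define R where "R i j \<longleftrightarrow> j \<le> i \<and> dependent_on m \<alpha> (d i) (d j)" for i j
  have R: "reflp R" "transp R"
    unfolding R_def by (auto simp: reflp_def transp_def intro: dependent_on_refl dependent_on_trans)
  have G_eq: "?G = {A. invertible A \<and> A \<in> incidence R}"
    unfolding G1_alpha_def eig incidence_def R_def
    by (auto simp: not_le[symmetric] dependent_on_refl) (metis dependent_on_refl linorder_not_le order_le_less)

  have \<beta>_0: "\<beta> i \<noteq> 0" for i
  proof
    assume "\<beta> i = 0"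
    then obtain x where "x \<noteq> 0" "?L *v x = 0" using \<beta>_eig[of i] by (auto simp: eigenvalues_def)
    then have "inv_jacobian 0 *v (?L *v x) = 0" by simp
    then show False using \<open>x \<noteq> 0\<close> by (simp add: matrix_vector_mul_assoc inv_jacobian_left)
  qed
  have \<beta>_1: "cmod (\<beta> i) < 1" for i
    using \<beta>_eig[of i] eigenvalue_jacobian_less_1 by (auto simp: eigenvalues_def)

  \<comment> \<open>vector fields are pulled back by the inverse Jacobian, whose normal form at \<open>0\<close> is \<open>T'\<close>\<close>
  define T' where "T' = Q' ** inv_jacobian 0 ** Q"
  have T'Q: "inv_jacobian 0 ** Q = Q ** T'"
    by (simp add: T'_def matrix_mul_assoc Q(1))
  have "T' ** T = mat 1"
  proof -
    have "T' ** T = Q' ** inv_jacobian 0 ** (Q ** T)" by (simp add: T'_def matrix_mul_assoc)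
    also have "\<dots> = Q' ** (inv_jacobian 0 ** ?L) ** Q" by (simp add: Q(3)[symmetric] matrix_mul_assoc)
    also have "\<dots> = mat 1" by (simp add: inv_jacobian_left Q(2))
    finally show ?thesis .
  qed
  moreover have "reflp (\<lambda>i j. j \<le> i \<and> \<beta> i = \<beta> j)" "transp (\<lambda>i j. j \<le> i \<and> \<beta> i = \<beta> j)"
    by (auto simp: reflp_def transp_def)
  ultimately have T'_inc: "T' \<in> incidence (\<lambda>i j. j \<le> i \<and> \<beta> i = \<beta> j)"
    using incidence_inverse T_inc by blast
  have T'_diag: "T' $ i $ i = 1 / \<beta> i" for i
  proof -
    have "1 = (\<Sum>k\<in>UNIV. T' $ i $ k * T $ k $ i)"
      using \<open>T' ** T = mat 1\<close> by (auto simp: vec_eq_iff matrix_matrix_mult_def mat_def)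
    also have "\<dots> = (\<Sum>k\<in>{i}. T' $ i $ k * T $ k $ i)"
      using T_inc T'_inc by (intro sum.mono_neutral_right) (auto simp: incidence_def intro: antisym)
    finally show ?thesis using \<beta>_0[of i] by (simp add: T_diag field_simps)
  qed

  have "\<exists>X M. holomorphic_map X \<and> X 0 = Q *v axis i 1 \<and> (fields.S (1 / \<beta> i) ^^ M) X = 0" for i
  proof -
    obtain N where "((\<lambda>u. T' *v u - 1 / \<beta> i *s u) ^^ N) (axis i 1) = 0"
      using generalised_eigenvector_axis[of T' "\<lambda>i. 1 / \<beta> i" position i] T'_diag T'_inc
      by (force simp: incidence_def position_less_iff)
    then have "((\<lambda>u. inv_jacobian 0 *v u - 1 / \<beta> i *s u) ^^ N) (Q *v axis i 1) = 0"
      using intertwined_funpow[OF T'Q] by simp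
    then show ?thesis using \<beta>_0 by (intro fields.generalised_eigenfield) auto
  qed
  then obtain X M where X: "\<And>i. holomorphic_map (X i)" "\<And>i. X i 0 = Q *v axis i 1"
    "\<And>i. (fields.S (1 / \<beta> i) ^^ M i) (X i) = 0" by metis

  \<comment> \<open>eigenforms extending the basis dual to the columns of \<open>Q\<close>; transposing \<open>T\<close> reverses the rank\<close>
  have "\<exists>\<theta> M. holomorphic_map \<theta> \<and> \<theta> 0 = transpose Q' *v axis i 1 \<and> (forms.S (\<beta> i) ^^ M) \<theta> = 0" for i
  proof -
    obtain N where "((\<lambda>u. transpose T *v u - \<beta> i *s u) ^^ N) (axis i 1) = 0"
    proof -
      have "\<exists>N. ((\<lambda>u. transpose T *v u - \<beta> i *s u) ^^ N) (axis i 1) = 0"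
      proof (rule generalised_eigenvector_axis[where rank = "\<lambda>l. CARD('n::{finite,linorder}) - position l"])
        show "transpose T $ l $ l = \<beta> l" for l by (simp add: transpose_def T_diag)
        fix l j assume "transpose T $ l $ j \<noteq> 0" "l \<noteq> j"
        then have "l < j" "\<beta> l = \<beta> j"
          using T_inc by (auto simp: transpose_def incidence_def order_less_le)
        then show "CARD('n::{finite,linorder}) - position j < CARD('n::{finite,linorder}) - position l \<and> \<beta> l = \<beta> j"
          using position_bounds(2)[of j] position_less_iff[of l j] by auto
      qed
      then show ?thesis using that by blast
    qed
    moreover have "transpose ?L ** transpose Q' = transpose Q' ** transpose T"
    proof -
      have "Q' ** ?L = Q' ** (?L ** Q) ** Q'" using Q(1) by (simp flip: matrix_mul_assoc)
      also have "\<dots> = T ** Q'" using Q(2) by (simp add: Q(3) matrix_mul_assoc)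
      finally show ?thesis by (simp flip: matrix_transpose_mul)
    qed
    ultimately have "((\<lambda>u. transpose ?L *v u - \<beta> i *s u) ^^ N) (transpose Q' *v axis i 1) = 0"
      using intertwined_funpow[of "transpose ?L" "transpose Q'" "transpose T"]
      by (simp del: transpose_matrix_vector)
    then show ?thesis using \<beta>_0 by (intro forms.generalised_eigenfield) auto
  qed
  then obtain \<theta> M' where \<theta>: "\<And>i. holomorphic_map (\<theta> i)" "\<And>i. \<theta> i 0 = transpose Q' *v axis i 1"
    "\<And>i. (forms.S (\<beta> i) ^^ M' i) (\<theta> i) = 0" by metis

  define frame where "frame x = (\<chi> r i. X i x $ r)" for x
  define coframe where "coframe x = (\<chi> l r. \<theta> l x $ r)" for x
  have frame_entire: "entire (\<lambda>x. frame x $ r $ i)" for r i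
    using X(1) by (simp add: frame_def holomorphic_map_def)
  have frame_0: "frame 0 = Q"
    by (simp add: frame_def X(2) vec_eq_iff matrix_vector_mult_def axis_def if_distrib[of "\<lambda>c. _ * c"] sum.delta cong: if_cong)
  have "\<exists>e>0. \<forall>x u. norm x < e \<longrightarrow> (\<forall>i. dot u (X i x) = 0) \<longrightarrow> u = 0"
  proof -
    have "continuous_on UNIV (\<lambda>x. det (frame x))"
      unfolding det_def by (intro continuous_intros entire_continuous frame_entire)
    moreover have "det (frame 0) \<noteq> 0"
      unfolding frame_0 using Q invertible_det_nz unfolding invertible_def by blast
    ultimately have "\<forall>\<^sub>F x in at 0. det (frame x) \<noteq> 0"
      unfolding continuous_on_def by (metis UNIV_I tendsto_imp_eventually_ne)
    then obtain e where e: "e > 0" "\<And>x. x \<noteq> 0 \<Longrightarrow> norm x < e \<Longrightarrow> det (frame x) \<noteq> 0"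
      unfolding eventually_at by (auto simp: dist_norm)
    have "u = 0" if x: "norm x < e" and u: "\<And>i. dot u (X i x) = 0" for x u
    proof -
      have "det (frame x) \<noteq> 0" using e(2)[of x] x \<open>det (frame 0) \<noteq> 0\<close> by (cases "x = 0") auto
      then have "invertible (transpose (frame x))" by (simp add: invertible_det_nz)
      moreover have "transpose (frame x) *v u = 0"
        using u by (simp add: vec_eq_iff dot_def frame_def transpose_def matrix_vector_mult_def
            mult.commute del: transpose_matrix_vector)
      ultimately show "u = 0"
        using matrix_left_invertible_ker[of "transpose (frame x)"] invertible_left_inverse by blast
    qed
    then show ?thesis using e(1) by blast
  qed
  then obtain e where e: "e > 0" "\<And>x u. norm x < e \<Longrightarrow> (\<And>i. dot u (X i x) = 0) \<Longrightarrow> u = 0" by blast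

  \<comment> \<open>
    The key step. The pairing of \<open>\<theta>\<^sub>l\<close> with a field \<open>Y\<close> in the eigenspace of \<open>X\<^sub>i\<close> is a generalised eigenfunction for
    \<open>\<beta>\<^sub>l / \<beta>\<^sub>i\<close>. If it is not zero, this quotient is a monomial in the eigenvalues, which is dependence. A
    nontrivial monomial is smaller than one in modulus, which forces \<open>i < l\<close>; for the trivial monomial the pairing is
    constant, and its position is decided at \<open>0\<close>.\<close>
  have pair_R: "R l i" and pair_diag: "l = i \<Longrightarrow> dot (\<theta> l y) (Y y) = dot (\<theta> l 0) (Y 0)"
    if Y: "holomorphic_map Y" "(fields.S (1 / \<beta> i) ^^ M i) Y = 0"
      and low: "dot (\<theta> l 0) (Y 0) \<noteq> 0 \<Longrightarrow> i \<le> l" and nz: "dot (\<theta> l x) (Y x) \<noteq> 0" for Y l i x y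
  proof -
    let ?f = "\<lambda>x. dot (\<theta> l x) (Y x)"
    have f: "entire ?f" by (rule entire_dot[OF \<theta>(1) Y(1)])
    have gen: "(koopman \<gamma> (\<beta> l * (1 / \<beta> i)) ^^ (M' l + M i)) ?f = (\<lambda>x. 0)"
      by (rule generalised_eigenfunction_dot[OF forms_fields_dual \<theta>(3) Y(2)])
    have const: "?f y = ?f 0" if "\<beta> l = \<beta> i" for y
      using gen generalised_eigenvalue_1_constant[OF f, of _ y] \<beta>_0[of i] by (simp add: that)
    then show "dot (\<theta> l y) (Y y) = dot (\<theta> l 0) (Y 0)" if "l = i" using that by simp
    have "?f \<noteq> (\<lambda>x. 0)" using nz by (metis (no_types))
    have "\<exists>p. \<beta> l * (1 / \<beta> i) = (\<Prod>j\<in>UNIV. \<beta> j ^ p j)"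
      by (rule eigenvalue_is_monomial[OF \<beta>_0 \<beta>_1 X(1,3) e(1) _ f gen \<open>?f \<noteq> (\<lambda>x. 0)\<close>])
        (rule e(2))
    then obtain p where "\<beta> l * (1 / \<beta> i) = (\<Prod>j\<in>UNIV. \<beta> j ^ p j)" by blast
    then have p: "\<beta> l = \<beta> i * (\<Prod>j\<in>UNIV. \<beta> j ^ p j)" using \<beta>_0[of i] by (simp add: field_simps)
    have "dependent_on m \<alpha> (d l) (d i)"
      by (rule dependent_onI[where p = p and d = d]) (simp_all only: d p[symmetric])
    moreover have "i \<le> l"
    proof (rule ccontr)
      assume "\<not> i \<le> l"
      then have abs: "cmod (\<beta> i) \<le> cmod (\<beta> l)" using \<beta>_abs[of l i] by simp
      have "\<beta> l = \<beta> i"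
      proof (cases "\<forall>j. p j = 0")
        case True then show ?thesis using p by simp
      next
        case False
        then obtain j where j: "p j \<noteq> 0" by blast
        have "cmod (\<Prod>j\<in>UNIV. \<beta> j ^ p j) = cmod (\<beta> j) ^ p j * (\<Prod>k\<in>UNIV - {j}. cmod (\<beta> k) ^ p k)"
          by (simp add: prod.remove[of UNIV j] norm_mult norm_power flip: prod_norm)
        also have "\<dots> \<le> cmod (\<beta> j) ^ p j * 1"
          by (intro mult_left_mono prod_le_1) (auto intro!: power_le_one less_imp_le[OF \<beta>_1])
        also have "\<dots> < 1" using \<beta>_1[of j] j by (simp add: power_less_one_iff)
        finally have "cmod (\<beta> l) < cmod (\<beta> i)"
          using \<beta>_0[of i] by (simp add: p norm_mult)
        then show ?thesis using abs by simp
      qed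
      then have "?f 0 \<noteq> 0" using const[of x] nz by simp
      then show False using low \<open>\<not> i \<le> l\<close> by blast
    qed
    ultimately show "R l i" by (simp add: R_def)
  qed

  \<comment> \<open>the pulled back fields lie in the same eigenspaces, so the key step applies to them as well\<close>
  let ?TX = "\<lambda>i. fields.T (X i)"
  have TX: "holomorphic_map (?TX i)" "(fields.S (1 / \<beta> i) ^^ M i) (?TX i) = 0" for i
  proof -
    show "holomorphic_map (?TX i)" by (rule fields.holomorphic_transfer[OF X(1)])
    show "(fields.S (1 / \<beta> i) ^^ M i) (?TX i) = 0"
      unfolding shifted_funpow_transfer X(3) by (simp add: transfer_def fun_eq_iff)
  qed
  have X_0: "dot (\<theta> l 0) (X i 0) = mat 1 $ l $ i" for l i
  proof -
    have "dot (\<theta> l 0) (X i 0) = dot (axis l 1) ((Q' ** Q) *v axis i 1)"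
      unfolding \<theta>(2) X(2) dot_transpose by (simp add: matrix_vector_mul_assoc)
    then show ?thesis by (simp only: dot_axis_matrix Q(2))
  qed
  have TX_0: "dot (\<theta> l 0) (?TX i 0) = T' $ l $ i" for l i
  proof -
    have "dot (\<theta> l 0) (?TX i 0) = dot (axis l 1) (T' *v axis i 1)"
      unfolding \<theta>(2) transfer_def fixes_0 X(2) dot_transpose T'_def
      by (simp add: matrix_vector_mul_assoc matrix_mul_assoc)
    then show ?thesis by (simp only: dot_axis_matrix)
  qed

  define A where "A x = coframe x ** frame x" for x
  define A' where "A' x = coframe x ** (inv_jacobian x ** frame (\<gamma> x))" for x
  have A: "A x $ l $ i = dot (\<theta> l x) (X i x)" for x l i
    by (simp add: A_def matrix_matrix_mult_def coframe_def frame_def dot_def)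
  have A': "A' x $ l $ i = dot (\<theta> l x) (?TX i x)" for x l i
    by (simp add: A'_def matrix_matrix_mult_def matrix_vector_mult_def coframe_def frame_def dot_def transfer_def)
  have A_inc: "A x \<in> incidence R" for x
    unfolding incidence_def mem_Collect_eq A
    by (auto simp: X_0 mat_def split: if_splits intro!: pair_R[OF X(1,3)])
  have A'_inc: "A' x \<in> incidence R" for x
    unfolding incidence_def mem_Collect_eq A'
    using T'_inc by (auto simp: TX_0 incidence_def intro!: pair_R[OF TX])
  have const_diag: "dot (\<theta> i x) (Y x) = dot (\<theta> i 0) (Y 0)"
    if Y: "holomorphic_map Y" "(fields.S (1 / \<beta> i) ^^ M i) Y = 0" and "dot (\<theta> i 0) (Y 0) \<noteq> 0" for Y i x
    using pair_diag[OF Y _ that(3)] by simp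
  have A_diag: "A x $ i $ i = 1" for x i
    unfolding A using const_diag[OF X(1,3)] by (simp add: X_0 mat_def)
  have A'_diag: "A' x $ i $ i = 1 / \<beta> i" for x i
    unfolding A' using const_diag[OF TX] by (simp add: TX_0 T'_diag \<beta>_0)
  have inv_tri: "invertible B" if "B \<in> incidence R" "\<And>i. B $ i $ i \<noteq> 0" for B
  proof -
    have "det B = (\<Prod>i\<in>UNIV. B $ i $ i)"
      using that(1) by (intro det_lower_triangular) (force simp: incidence_def R_def)
    then show ?thesis using that(2) by (simp add: invertible_det_nz)
  qed
  \<comment> \<open>triangular with constant nonzero diagonal: hence \<open>X\<close> is a frame at every point, not only near \<open>0\<close>\<close>
  have A_inv: "invertible (A x)" for x using inv_tri[OF A_inc] by (simp add: A_diag)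
  have A'_inv: "invertible (A' x)" for x using inv_tri[OF A'_inc] by (simp add: A'_diag \<beta>_0)
  have "det (A x) = det (coframe x) * det (frame x)" for x by (simp add: A_def det_mul)
  then have frame_inv: "invertible (frame x)" and coframe_inv: "invertible (coframe x)" for x
    using A_inv[of x] by (simp_all add: invertible_det_nz)

  have G_mult: "g ** h \<in> ?G" if "g \<in> ?G" "h \<in> ?G" for g h
    using that R unfolding G_eq by (auto intro: incidence_mult invertible_mult)
  have G_inv: "\<exists>h\<in>?G. g ** h = mat 1 \<and> h ** g = mat 1" if g: "g \<in> ?G" for g
  proof -
    obtain h where h: "g ** h = mat 1" "h ** g = mat 1" using g unfolding G_eq invertible_def by blast
    then have "h \<in> incidence R" using incidence_inverse[OF R] g unfolding G_eq by blast
    then show ?thesis using h unfolding G_eq invertible_def by blast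
  qed
  show ?thesis
  proof (rule invariant_structure_of_frame[where s = frame])
    show "biholomorphism \<gamma>" using assms(2) unfolding contraction_at_0_def by blast
    show "\<exists>h\<in>?G. g ** h = mat 1" if "g \<in> ?G" for g using G_inv[OF that] by blast
    show "invertible g" if "g \<in> ?G" for g using that unfolding G_eq by blast
    show "\<exists>h\<in>?G. jacobian \<gamma> (at x) ** frame x = frame (\<gamma> x) ** h" for x
    proof -
      have "A x \<in> ?G" "A' x \<in> ?G" unfolding G_eq using A_inc A_inv A'_inc A'_inv by auto
      then obtain h where h: "h \<in> ?G" "A' x ** h = mat 1" and G: "h ** A x \<in> ?G"
        using G_inv G_mult by meson
      \<comment> \<open>the pulled back frame is \<open>frame x\<close> times \<open>(A x)\<inverse> A' x\<close>, and \<open>h\<close> is the inverse of \<open>A' x\<close>\<close>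
      obtain C where C: "C ** coframe x = mat 1" using coframe_inv unfolding invertible_def by blast
      have "inv_jacobian x ** frame (\<gamma> x) = C ** A' x"
        using C by (simp add: A'_def matrix_mul_assoc)
      then have "inv_jacobian x ** frame (\<gamma> x) ** (h ** A x) = C ** (A' x ** h) ** A x"
        by (simp add: matrix_mul_assoc)
      also have "\<dots> = frame x" using h(2) C by (simp add: A_def matrix_mul_assoc)
      finally have "jacobian \<gamma> (at x) ** frame x
          = jacobian \<gamma> (at x) ** (inv_jacobian x ** frame (\<gamma> x) ** (h ** A x))" by simp
      also have "\<dots> = (jacobian \<gamma> (at x) ** inv_jacobian x) ** frame (\<gamma> x) ** (h ** A x)"
        by (simp only: matrix_mul_assoc)
      finally have "jacobian \<gamma> (at x) ** frame x = frame (\<gamma> x) ** (h ** A x)"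
        by (simp add: inv_jacobian_right)
      then show ?thesis using G by blast
    qed
  qed (fact G_mult frame_entire frame_inv)+
qed

end
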